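(* In the ring of formal power series in $y$ with coefficients in the ring of symmetric functions in $\mathbf{x}=(x_1,x_2,\dots)$, $$\sum_{n\ge1}\sum_{\mu\in\mathrm{WComp}_{n-1}}\dim\mathcal{L}ie(\mu)\,\mathbf{x}^{\mu}\frac{y^n}{n!}=\left[\sum_{n\ge1}(-1)^{n-1}h_{n-1}(\mathbf{x})\frac{y^n}{n!}\right]^{<-1>},$$ where $h_n$ is the complete homogeneous symmetric function, $\mathbf{x}^\mu=x_1^{\mu(1)}x_2^{\mu(2)}\cdots$, and $(\cdot)^{<-1>}$ is the compositional inverse with respect to $y$.
   Context: Fix a field $\mathbf{k}$. $\mathrm{WComp}_n$ is the set of weak compositions $\mu=(\mu(1),\mu(2),\dots)$ (nonnegative integers, finitely many nonzero) with $\sum_i\mu(i)=n$. With brackets $[\cdot,\cdot]_j$, $j\in\mathbb{P}$, $\mathcal{L}ie_{\mathbb{P}}(n)$ is the $\mathbf{k}$-span of all bracketed permutations of $[n]$ (each bracket carrying a type $j$, each letter of $[n]$ used exactly once) subject only to antisymmetry and the Jacobi identity for each bracket type and compatibility of the brackets (every linear combination of brackets is a Lie bracket; equivalently the mixed Jacobi relation $[x,[y,z]_j]_i+[z,[x,y]_j]_i+[y,[z,x]_j]_i+[x,[y,z]_i]_j+[z,[x,y]_i]_j+[y,[z,x]_i]_j=0$ for all $i\ne j$). For $\mu\in\mathrm{WComp}_{n-1}$, $\mathcal{L}ie(\mu)$ is the subspace spanned by bracketed permutations with exactly $\mu(j)$ brackets of type $j$ for all $j$. *)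

theory Defs
  imports
    Complex_Main
    "HOL-Library.Poly_Mapping"
    "HOL-Computational_Algebra.Formal_Power_Series"
begin

section \<open>Weak compositions\<close>

text \<open>
  A weak composition is a finitely supported function on the natural numbers. The index set
  \<open>{1, 2, \<dots>}\<close> of the variables and of the bracket types is represented by the type \<open>nat\<close>:
  the index \<open>i\<close> below stands for the positive integer \<open>i + 1\<close>.
\<close>

definition WComp :: "nat \<Rightarrow> (nat \<Rightarrow>\<^sub>0 nat) set"
  where "WComp n = {\<mu>. (\<Sum>i\<in>Poly_Mapping.keys \<mu>. Poly_Mapping.lookup \<mu> i) = n}"


section \<open>Formal power series in infinitely many variables, and symmetric functions\<close>

text \<open>
  Power series over the rationals in the variables \<open>x\<^sub>i\<close>; a monomial is identified with its
  exponent vector, and a series with its family of coefficients.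
\<close>

typedef xseries = "UNIV :: ((nat \<Rightarrow>\<^sub>0 nat) \<Rightarrow> rat) set"
  morphisms xcoeff Abs_xseries ..

setup_lifting type_definition_xseries

lemma xseries_eqI: "(\<And>\<mu>. xcoeff f \<mu> = xcoeff g \<mu>) \<Longrightarrow> f = g"
  by transfer auto

lemma finite_decompositions:
  fixes \<mu> :: "nat \<Rightarrow>\<^sub>0 nat"
  shows "finite {(\<alpha>, \<beta>). \<alpha> + \<beta> = \<mu>}"
proof -
  let ?K = "Poly_Mapping.keys \<mu>"
  let ?B = "\<Pi>\<^sub>E i\<in>?K. {..Poly_Mapping.lookup \<mu> i}"
  let ?r = "\<lambda>\<alpha>. restrict (Poly_Mapping.lookup \<alpha>) ?K"
  have fin: "finite ?B"
    by (intro finite_PiE) auto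
  have dec: "\<exists>\<beta>. \<alpha> + \<beta> = \<mu> \<Longrightarrow> Poly_Mapping.lookup \<alpha> i \<le> Poly_Mapping.lookup \<mu> i" for \<alpha> i
    by (auto simp: lookup_add)
  have "inj_on ?r {\<alpha>. \<exists>\<beta>. \<alpha> + \<beta> = \<mu>}"
  proof (rule inj_onI)
    fix \<alpha> \<alpha>'
    assume a: "\<alpha> \<in> {\<alpha>. \<exists>\<beta>. \<alpha> + \<beta> = \<mu>}" "\<alpha>' \<in> {\<alpha>. \<exists>\<beta>. \<alpha> + \<beta> = \<mu>}"
      and eq: "?r \<alpha> = ?r \<alpha>'"
    show "\<alpha> = \<alpha>'"
    proof (rule poly_mapping_eqI)
      fix i
      show "Poly_Mapping.lookup \<alpha> i = Poly_Mapping.lookup \<alpha>' i"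
      proof (cases "i \<in> ?K")
        case True
        then show ?thesis using fun_cong[OF eq, of i] by simp
      next
        case False
        then have "Poly_Mapping.lookup \<mu> i = 0"
          by (simp add: in_keys_iff)
        with a dec[of \<alpha> i] dec[of \<alpha>' i] show ?thesis by simp
      qed
    qed
  qed
  moreover have "?r ` {\<alpha>. \<exists>\<beta>. \<alpha> + \<beta> = \<mu>} \<subseteq> ?B"
    using dec by (auto)
  ultimately have A: "finite {\<alpha>. \<exists>\<beta>. \<alpha> + \<beta> = \<mu>}"
    using fin by (rule inj_on_finite)
  have "{(\<alpha>, \<beta>). \<alpha> + \<beta> = \<mu>} \<subseteq> (\<lambda>\<alpha>. (\<alpha>, \<mu> - \<alpha>)) ` {\<alpha>. \<exists>\<beta>. \<alpha> + \<beta> = \<mu>}"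
    by force
  then show ?thesis
    using A by (rule finite_surj[rotated])
qed

instantiation xseries :: comm_ring_1
begin

lift_definition zero_xseries :: xseries is "\<lambda>_. 0" .
lift_definition one_xseries :: xseries is "\<lambda>\<mu>. if \<mu> = 0 then 1 else 0" .
lift_definition plus_xseries :: "xseries \<Rightarrow> xseries \<Rightarrow> xseries" is "\<lambda>f g \<mu>. f \<mu> + g \<mu>" .
lift_definition minus_xseries :: "xseries \<Rightarrow> xseries \<Rightarrow> xseries" is "\<lambda>f g \<mu>. f \<mu> - g \<mu>" .
lift_definition uminus_xseries :: "xseries \<Rightarrow> xseries" is "\<lambda>f \<mu>. - f \<mu>" .
lift_definition times_xseries :: "xseries \<Rightarrow> xseries \<Rightarrow> xseries"
  is "\<lambda>f g \<mu>. \<Sum>(\<alpha>, \<beta>)\<in>{(\<alpha>, \<beta>). \<alpha> + \<beta> = \<mu>}. f \<alpha> * g \<beta>" .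

instance
proof
  fix f g h :: xseries
  show "f * g * h = f * (g * h)"
  proof (transfer, rule ext)
    fix f g h :: "(nat \<Rightarrow>\<^sub>0 nat) \<Rightarrow> rat" and \<mu> :: "nat \<Rightarrow>\<^sub>0 nat"
    let ?D = "\<lambda>\<mu> :: nat \<Rightarrow>\<^sub>0 nat. {(\<alpha>, \<beta>). \<alpha> + \<beta> = \<mu>}"
    have "(\<Sum>(\<alpha>, \<gamma>)\<in>?D \<mu>. (\<Sum>(\<alpha>', \<beta>)\<in>?D \<alpha>. f \<alpha>' * g \<beta>) * h \<gamma>)
        = (\<Sum>p\<in>?D \<mu>. \<Sum>q\<in>?D (fst p). f (fst q) * g (snd q) * h (snd p))"
      by (simp add: sum_distrib_right case_prod_beta)
    also have "\<dots> = (\<Sum>(p, q)\<in>(SIGMA p:?D \<mu>. ?D (fst p)). f (fst q) * g (snd q) * h (snd p))"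
      by (rule sum.Sigma) (auto simp: finite_decompositions)
    also have "\<dots> = (\<Sum>(p, q)\<in>(SIGMA p:?D \<mu>. ?D (snd p)). f (fst p) * (g (fst q) * h (snd q)))"
      by (rule sum.reindex_bij_witness[where
            i = "\<lambda>((\<alpha>, _), (\<beta>, \<gamma>)). ((\<alpha> + \<beta>, \<gamma>), (\<alpha>, \<beta>))" and
            j = "\<lambda>((_, \<gamma>), (\<alpha>, \<beta>)). ((\<alpha>, \<beta> + \<gamma>), (\<beta>, \<gamma>))"])
        (auto simp: ac_simps)
    also have "\<dots> = (\<Sum>p\<in>?D \<mu>. \<Sum>q\<in>?D (snd p). f (fst p) * (g (fst q) * h (snd q)))"
      by (rule sum.Sigma[symmetric]) (auto simp: finite_decompositions)
    also have "\<dots> = (\<Sum>(\<alpha>, \<gamma>)\<in>?D \<mu>. f \<alpha> * (\<Sum>(\<beta>, \<gamma>)\<in>?D \<gamma>. g \<beta> * h \<gamma>))"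
      by (simp add: sum_distrib_left case_prod_beta)
    finally show "(\<Sum>(\<alpha>, \<gamma>)\<in>?D \<mu>. (\<Sum>(\<alpha>', \<beta>)\<in>?D \<alpha>. f \<alpha>' * g \<beta>) * h \<gamma>)
        = (\<Sum>(\<alpha>, \<gamma>)\<in>?D \<mu>. f \<alpha> * (\<Sum>(\<beta>, \<gamma>)\<in>?D \<gamma>. g \<beta> * h \<gamma>))" .
  qed
  show "f * g = g * f"
  proof (transfer, rule ext)
    fix f g :: "(nat \<Rightarrow>\<^sub>0 nat) \<Rightarrow> rat" and \<mu> :: "nat \<Rightarrow>\<^sub>0 nat"
    show "(\<Sum>(\<alpha>, \<beta>)\<in>{(\<alpha>, \<beta>). \<alpha> + \<beta> = \<mu>}. f \<alpha> * g \<beta>)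
        = (\<Sum>(\<alpha>, \<beta>)\<in>{(\<alpha>, \<beta>). \<alpha> + \<beta> = \<mu>}. g \<alpha> * f \<beta>)"
      by (rule sum.reindex_bij_witness[where i = prod.swap and j = prod.swap])
        (auto simp: ac_simps)
  qed
  show "1 * f = f"
  proof (transfer, rule ext)
    fix f :: "(nat \<Rightarrow>\<^sub>0 nat) \<Rightarrow> rat" and \<mu> :: "nat \<Rightarrow>\<^sub>0 nat"
    have "(\<Sum>(\<alpha>, \<beta>)\<in>{(\<alpha>, \<beta>). \<alpha> + \<beta> = \<mu>}. (if \<alpha> = 0 then 1 else 0) * f \<beta>)
        = (\<Sum>(\<alpha>, \<beta>)\<in>{(0 :: nat \<Rightarrow>\<^sub>0 nat, \<mu>)}. (if \<alpha> = 0 then 1 else 0) * f \<beta>)"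
      by (rule sum.mono_neutral_right) (auto simp: finite_decompositions split: if_splits)
    then show "(\<Sum>(\<alpha>, \<beta>)\<in>{(\<alpha>, \<beta>). \<alpha> + \<beta> = \<mu>}. (if \<alpha> = 0 then 1 else 0) * f \<beta>) = f \<mu>"
      by simp
  qed
  show "(f + g) * h = f * h + g * h"
    by transfer (simp add: fun_eq_iff case_prod_beta distrib_right sum.distrib)
  show "(0 :: xseries) \<noteq> 1"
    by transfer (auto simp: fun_eq_iff)
  show "f + g + h = f + (g + h)"
    by transfer (simp add: fun_eq_iff)
  show "f + g = g + f"
    by transfer (simp add: fun_eq_iff)
  show "0 + f = f"
    by transfer simp
  show "- f + f = 0"
    by transfer simp
  show "f - g = f + - g"
    by transfer simp
qed

end

definition xconst :: "rat \<Rightarrow> xseries"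
  where "xconst c = Abs_xseries (\<lambda>\<mu>. if \<mu> = 0 then c else 0)"

text \<open>The (in general infinite) formal sum of the terms \<open>c \<mu> x\<^sup>\<mu>\<close> over \<open>\<mu> \<in> S\<close>.\<close>

definition xsum :: "(nat \<Rightarrow>\<^sub>0 nat) set \<Rightarrow> ((nat \<Rightarrow>\<^sub>0 nat) \<Rightarrow> rat) \<Rightarrow> xseries"
  where "xsum S c = Abs_xseries (\<lambda>\<mu>. if \<mu> \<in> S then c \<mu> else 0)"

lemma xcoeff_simps:
  "xcoeff 0 \<mu> = 0"
  "xcoeff 1 \<mu> = (if \<mu> = 0 then 1 else 0)"
  "xcoeff (f + g) \<mu> = xcoeff f \<mu> + xcoeff g \<mu>"
  "xcoeff (f - g) \<mu> = xcoeff f \<mu> - xcoeff g \<mu>"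
  "xcoeff (- f) \<mu> = - xcoeff f \<mu>"
  "xcoeff (f * g) \<mu> = (\<Sum>(\<alpha>, \<beta>)\<in>{(\<alpha>, \<beta>). \<alpha> + \<beta> = \<mu>}. xcoeff f \<alpha> * xcoeff g \<beta>)"
  "xcoeff (xconst c) \<mu> = (if \<mu> = 0 then c else 0)"
  "xcoeff (xsum S a) \<mu> = (if \<mu> \<in> S then a \<mu> else 0)"
  by (simp_all add: zero_xseries.rep_eq one_xseries.rep_eq plus_xseries.rep_eq
      minus_xseries.rep_eq uminus_xseries.rep_eq times_xseries.rep_eq
      xconst_def xsum_def Abs_xseries_inverse)

text \<open>Symmetric functions are the series of bounded degree invariant under permuting variables.\<close>

definition symmetric_function :: "xseries \<Rightarrow> bool" where
  "symmetric_function f \<longleftrightarrow>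
     (\<exists>d. \<forall>n \<mu>. \<mu> \<in> WComp n \<longrightarrow> xcoeff f \<mu> \<noteq> 0 \<longrightarrow> n \<le> d) \<and>
     (\<forall>p \<mu>. bij p \<longrightarrow> xcoeff f (Poly_Mapping.map_key p \<mu>) = xcoeff f \<mu>)"

text \<open>The sum of all monomials of degree \<open>n\<close>.\<close>

definition complete_homogeneous :: "nat \<Rightarrow> xseries"
  where "complete_homogeneous n = xsum (WComp n) (\<lambda>_. 1)"

text \<open>The series with coefficient \<open>a n / n!\<close> at \<open>y\<^sup>n\<close> for \<open>n \<ge> 1\<close> and zero constant term.\<close>

definition egf :: "(nat \<Rightarrow> xseries) \<Rightarrow> xseries fps"
  where "egf a = Abs_fps (\<lambda>n. if n = 0 then 0 else xconst (1 / fact n) * a n)"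

definition compositional_inverse :: "'a::comm_ring_1 fps \<Rightarrow> 'a fps \<Rightarrow> bool" where
  "compositional_inverse F G \<longleftrightarrow>
     fps_nth F 0 = 0 \<and> fps_nth G 0 = 0 \<and> F oo G = fps_X \<and> G oo F = fps_X"


section \<open>Bracketed permutations\<close>

text \<open>\<open>Br j s t\<close> is the bracketing \<open>[s, t]\<^sub>j\<close>.\<close>

datatype bracketing = Leaf nat | Br nat bracketing bracketing

fun letters :: "bracketing \<Rightarrow> nat list" where
  "letters (Leaf a) = [a]"
| "letters (Br j s t) = letters s @ letters t"

fun bracket_types :: "bracketing \<Rightarrow> (nat \<Rightarrow>\<^sub>0 nat)" where
  "bracket_types (Leaf a) = 0"
| "bracket_types (Br j s t) = Poly_Mapping.single j 1 + bracket_types s + bracket_types t"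

definition bracketed_permutation :: "nat \<Rightarrow> bracketing \<Rightarrow> bool" where
  "bracketed_permutation n t \<longleftrightarrow> distinct (letters t) \<and> set (letters t) = {1..n}"

text \<open>A bracketing with one subtree left out; the relations hold at every position of a bracketing.\<close>

datatype bracketing_context =
  Hole | InLeft nat bracketing_context bracketing | InRight nat bracketing bracketing_context

fun plug :: "bracketing_context \<Rightarrow> bracketing \<Rightarrow> bracketing" where
  "plug Hole u = u"
| "plug (InLeft j C t) u = Br j (plug C u) t"
| "plug (InRight j s C) u = Br j s (plug C u)"


section \<open>The free vector space on bracketings, and its quotient\<close>

definition free_scale :: "'k::field \<Rightarrow> (bracketing \<Rightarrow>\<^sub>0 'k) \<Rightarrow> (bracketing \<Rightarrow>\<^sub>0 'k)"
  where "free_scale c v = Poly_Mapping.map ((*) c) v"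

lemma lookup_free_scale [simp]:
  "Poly_Mapping.lookup (free_scale c v) t = c * Poly_Mapping.lookup v t"
  unfolding free_scale_def by (simp add: Poly_Mapping.map.rep_eq when_def)

interpretation free: vector_space "free_scale :: 'k::field \<Rightarrow> _"
  by unfold_locales (auto intro!: poly_mapping_eqI simp: lookup_add algebra_simps)

abbreviation basis_vector :: "bracketing \<Rightarrow> (bracketing \<Rightarrow>\<^sub>0 'k::field)"
  where "basis_vector t \<equiv> Poly_Mapping.single t 1"

text \<open>
  The defining relations among the bracketed permutations of \<open>{1..n}\<close>: antisymmetry, the Jacobi
  identity for each bracket, and the mixed Jacobi identity for each pair of brackets. All terms of
  one relation have the same letters, so the side condition on one term covers all of them.
\<close>

inductive_set lie_relations :: "nat \<Rightarrow> (bracketing \<Rightarrow>\<^sub>0 'k::field) set" for n where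
  antisymmetry: "bracketed_permutation n (plug C (Br j x y)) \<Longrightarrow>
    basis_vector (plug C (Br j x y)) + basis_vector (plug C (Br j y x)) \<in> lie_relations n"
| jacobi: "bracketed_permutation n (plug C (Br j x (Br j y z))) \<Longrightarrow>
    basis_vector (plug C (Br j x (Br j y z)))
    + basis_vector (plug C (Br j z (Br j x y)))
    + basis_vector (plug C (Br j y (Br j z x))) \<in> lie_relations n"
| mixed_jacobi: "bracketed_permutation n (plug C (Br i x (Br j y z))) \<Longrightarrow> i \<noteq> j \<Longrightarrow>
    basis_vector (plug C (Br i x (Br j y z)))
    + basis_vector (plug C (Br i z (Br j x y)))
    + basis_vector (plug C (Br i y (Br j z x)))
    + basis_vector (plug C (Br j x (Br i y z)))
    + basis_vector (plug C (Br j z (Br i x y)))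
    + basis_vector (plug C (Br j y (Br i z x))) \<in> lie_relations n"

definition relation_space :: "(bracketing \<Rightarrow>\<^sub>0 'k::field) set"
  where "relation_space = free.span (\<Union>n. lie_relations n)"

lemma relation_space_closed:
  "0 \<in> relation_space"
  "v \<in> relation_space \<Longrightarrow> w \<in> relation_space \<Longrightarrow> v + w \<in> relation_space"
  "v \<in> relation_space \<Longrightarrow> w \<in> relation_space \<Longrightarrow> v - w \<in> relation_space"
  "v \<in> relation_space \<Longrightarrow> - v \<in> relation_space"
  "v \<in> relation_space \<Longrightarrow> free_scale c v \<in> relation_space"
  unfolding relation_space_def
  by (auto intro: free.span_zero free.span_add free.span_diff free.span_neg free.span_scale)

text \<open>
  The quotient of the free vector space on all bracketings by the relations. The relations for
  different \<open>n\<close> involve disjoint sets of basis vectors, so inside this quotient the span of the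
  bracketed permutations of \<open>{1..n}\<close> is the space presented by those bracketed permutations
  subject only to \<open>lie_relations n\<close>.
\<close>

quotient_type (overloaded) 'k lie = "bracketing \<Rightarrow>\<^sub>0 'k::field" /
  "\<lambda>v w. v - w \<in> relation_space"
proof (rule equivpI)
  show "reflp (\<lambda>v w :: bracketing \<Rightarrow>\<^sub>0 'k. v - w \<in> relation_space)"
    by (rule reflpI) (simp add: relation_space_closed)
  show "symp (\<lambda>v w :: bracketing \<Rightarrow>\<^sub>0 'k. v - w \<in> relation_space)"
    by (rule sympI) (drule relation_space_closed(4), simp)
  show "transp (\<lambda>v w :: bracketing \<Rightarrow>\<^sub>0 'k. v - w \<in> relation_space)"
    by (rule transpI) (drule (1) relation_space_closed(2), simp)
qed

instantiation lie :: (field) ab_group_add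
begin

lift_definition zero_lie :: "'a lie" is 0 .
lift_definition plus_lie :: "'a lie \<Rightarrow> 'a lie \<Rightarrow> 'a lie" is "(+)"
  by (drule (1) relation_space_closed(2)) (simp add: algebra_simps)
lift_definition uminus_lie :: "'a lie \<Rightarrow> 'a lie" is uminus
  by (drule relation_space_closed(4)) (simp add: algebra_simps)
lift_definition minus_lie :: "'a lie \<Rightarrow> 'a lie \<Rightarrow> 'a lie" is "(-)"
  by (drule (1) relation_space_closed(3)) (simp add: algebra_simps)

instance
proof
  fix a b c :: "'a lie"
  show "a + b + c = a + (b + c)"
    by transfer (simp add: add.assoc relation_space_closed(1))
  show "a + b = b + a"
    by transfer (simp add: add.commute relation_space_closed(1))
  show "0 + a = a"
    by transfer (simp add: relation_space_closed(1))
  show "- a + a = 0"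
    by transfer (simp add: relation_space_closed(1))
  show "a - b = a + - b"
    by transfer (simp add: relation_space_closed(1))
qed

end

lift_definition lie_scale :: "'k::field \<Rightarrow> 'k lie \<Rightarrow> 'k lie" is free_scale
  by (metis free.scale_right_diff_distrib relation_space_closed(5))

interpretation lie: vector_space "lie_scale :: 'k::field \<Rightarrow> _"
proof
  fix a b :: 'k and x y :: "'k lie"
  show "lie_scale a (x + y) = lie_scale a x + lie_scale a y"
    by transfer (simp add: free.scale_right_distrib relation_space_closed(1))
  show "lie_scale (a + b) x = lie_scale a x + lie_scale b x"
    by transfer (simp add: free.scale_left_distrib relation_space_closed(1))
  show "lie_scale a (lie_scale b x) = lie_scale (a * b) x"
    by transfer (simp add: relation_space_closed(1))
  show "lie_scale 1 x = x"
    by transfer (simp add: relation_space_closed(1))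
qed

lift_definition lie_class :: "bracketing \<Rightarrow> 'k::field lie" is basis_vector .

definition Lie_P :: "nat \<Rightarrow> 'k::field lie set"
  where "Lie_P n = lie.span {lie_class t | t. bracketed_permutation n t}"

definition Lie :: "nat \<Rightarrow> (nat \<Rightarrow>\<^sub>0 nat) \<Rightarrow> 'k::field lie set"
  where "Lie n \<mu> = lie.span {lie_class t | t. bracketed_permutation n t \<and> bracket_types t = \<mu>}"

lemma Lie_subset_Lie_P: "Lie n \<mu> \<subseteq> Lie_P n"
  unfolding Lie_def Lie_P_def by (rule lie.span_mono) auto

text \<open>\<open>\<Sum>\<^bsub>\<mu> \<in> WComp (n - 1)\<^esub> dim Lie(\<mu>) x\<^sup>\<mu>\<close>, over the field \<open>'k\<close>.\<close>

definition lie_dim_gf :: "'k::field itself \<Rightarrow> nat \<Rightarrow> xseries"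
  where "lie_dim_gf _ n = xsum (WComp (n - 1)) (\<lambda>\<mu>. of_nat (lie.dim (Lie n \<mu> :: 'k lie set)))"

end

theory Submission
  imports Defs
begin

text \<open>
  A bracketing is a colored comb if in every subtree the least letter is leftmost and if, for
  every bracket whose right argument is itself a bracket, that argument has the smaller type. The colored
  combs with \<open>\<mu>(j)\<close> brackets of type \<open>j\<close> form a basis of \<open>\<L>ie(\<mu>)\<close>.

  Spanning: \<open>[A, [D, E]\<^sub>j]\<^sub>i\<close> with \<open>i \<le> j\<close> is rewritten by the (mixed) Jacobi relation into brackets with
  smaller right argument and \<open>[A, [D, E]\<^sub>i]\<^sub>j\<close>, whose right argument has smaller type sum.

  Independence: the same rewriting rules define products \<open>\<cdot>\<^sub>i\<close> on the span of all bracketings which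
  satisfy the right Leibniz rule \<open>a(cd) = (ac)d - (ad)c\<close> for every linear combination of the products.
  Antisymmetrizing them according to the least letters gives a linear map that respects all
  relations and fixes the colored combs.

  Counting: let \<open>F\<close> be the generating function of colored combs and \<open>F\<^sub>c\<close> that of those with root type
  below \<open>c\<close>. Removing the root gives \<open>(F\<^bsub>c+1\<^esub> - F\<^sub>c)' = x\<^sub>c F\<^sub>c F'\<close>. The series
  \<open>H\<^sub>c(u) = \<Sum> (-1)\<^bsup>n-1\<^esup> h\<^bsub>n-1\<^esub>(x\<^sub>c, x\<^bsub>c+1\<^esub>, \<dots>) u\<^sup>n / n!\<close> satisfy \<open>(H\<^bsub>c+1\<^esub> - H\<^sub>c)' = x\<^sub>c H\<^sub>c\<close>, so \<open>H\<^sub>c(F)\<close> obeys the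
  same recursion as \<open>F\<^sub>c\<close>; both tend to \<open>F\<close> as \<open>c \<rightarrow> \<infinity>\<close>, hence they agree, and \<open>c = 0\<close> is
  \<open>H(F) = y\<close>. As \<open>H\<close> is symmetric, so is its inverse.
\<close>

section \<open>Compatible Leibniz products on the span of bracketings\<close>

definition ext :: "(bracketing \<Rightarrow> (bracketing \<Rightarrow>\<^sub>0 'k::field)) \<Rightarrow> (bracketing \<Rightarrow>\<^sub>0 'k) \<Rightarrow> (bracketing \<Rightarrow>\<^sub>0 'k)"
  where "ext f v = (\<Sum>t\<in>Poly_Mapping.keys v. free_scale (Poly_Mapping.lookup v t) (f t))"

lemma ext_superset:
  assumes "finite S" "Poly_Mapping.keys v \<subseteq> S"
  shows "ext f v = (\<Sum>t\<in>S. free_scale (Poly_Mapping.lookup v t) (f t))"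
  unfolding ext_def
  by (rule sum.mono_neutral_left) (use assms in \<open>auto simp: in_keys_iff\<close>)

lemma ext_add: "ext f (v + w) = ext f v + ext f w"
proof -
  let ?S = "Poly_Mapping.keys v \<union> Poly_Mapping.keys w"
  have "Poly_Mapping.keys (v + w) \<subseteq> ?S"
    by (rule Poly_Mapping.keys_add)
  then show ?thesis
    by (simp add: ext_superset[of ?S] lookup_add free.scale_left_distrib sum.distrib)
qed

lemma ext_zero [simp]: "ext f 0 = 0"
  by (simp add: ext_def)

lemma ext_uminus: "ext f (- v) = - ext f v"
  using ext_add[of f v "- v"] by (simp add: eq_neg_iff_add_eq_0 add.commute)

lemma ext_diff: "ext f (v - w) = ext f v - ext f w"
  using ext_add[of f v "- w"] by (simp add: ext_uminus)

lemma ext_scale: "ext f (free_scale c v) = free_scale c (ext f v)"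
proof -
  have "Poly_Mapping.keys (free_scale c v) \<subseteq> Poly_Mapping.keys v"
    by (auto simp: in_keys_iff)
  then show ?thesis
    by (simp add: ext_superset[of "Poly_Mapping.keys v"] free.scale_sum_right)
qed

lemma ext_basis [simp]: "ext f (basis_vector t) = f t"
  by (simp add: ext_def)

lemma ext_cong: "(\<And>t. t \<in> Poly_Mapping.keys v \<Longrightarrow> f t = g t) \<Longrightarrow> ext f v = ext g v"
  unfolding ext_def by (rule sum.cong) auto

lemma ext_fun_zero: "(\<And>t. t \<in> Poly_Mapping.keys v \<Longrightarrow> f t = 0) \<Longrightarrow> ext f v = 0"
  unfolding ext_def by (rule sum.neutral) auto

lemma ext_fun_add: "ext (\<lambda>t. f t + g t) v = ext f v + ext g v"
  unfolding ext_def by (simp add: free.scale_right_distrib sum.distrib)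

lemma ext_fun_diff: "ext (\<lambda>t. f t - g t) v = ext f v - ext g v"
  unfolding ext_def by (simp add: free.scale_right_diff_distrib sum_subtractf)

lemma ext_basis_vector [simp]: "ext basis_vector v = v"
  unfolding ext_def
  by (rule poly_mapping_eqI)
    (simp add: lookup_sum lookup_single when_def if_distrib sum.delta in_keys_iff cong: if_cong)

lemma keys_ext: "Poly_Mapping.keys (ext f v) \<subseteq> (\<Union>t\<in>Poly_Mapping.keys v. Poly_Mapping.keys (f t))"
proof
  fix u assume "u \<in> Poly_Mapping.keys (ext f v)"
  then have "(\<Sum>t\<in>Poly_Mapping.keys v. Poly_Mapping.lookup v t * Poly_Mapping.lookup (f t) u) \<noteq> 0"
    by (simp add: ext_def lookup_sum in_keys_iff)
  then obtain t where "t \<in> Poly_Mapping.keys v" "Poly_Mapping.lookup v t * Poly_Mapping.lookup (f t) u \<noteq> 0"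
    by (meson sum.neutral)
  then show "u \<in> (\<Union>t\<in>Poly_Mapping.keys v. Poly_Mapping.keys (f t))"
    by (auto simp: in_keys_iff)
qed

text \<open>Second component, after \<open>size\<close>, of the measure that rewriting decreases.
  Reading it off \<open>bracket_types\<close> rather than recursively makes it evident that
  bracketings with the same types agree in it.\<close>

definition color_sum :: "bracketing \<Rightarrow> nat"
  where "color_sum t = (\<Sum>i\<in>Poly_Mapping.keys (bracket_types t). Poly_Mapping.lookup (bracket_types t) i * i)"

lemma color_sum_simps [simp]:
  "color_sum (Leaf a) = 0"
  "color_sum (Br j s t) = j + color_sum s + color_sum t"
proof -
  show "color_sum (Leaf a) = 0" by (simp add: color_sum_def)
  define S where "S = insert j (Poly_Mapping.keys (bracket_types s) \<union> Poly_Mapping.keys (bracket_types t))"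
  have S: "color_sum u = (\<Sum>i\<in>S. Poly_Mapping.lookup (bracket_types u) i * i)"
    if "Poly_Mapping.keys (bracket_types u) \<subseteq> S" for u
    unfolding color_sum_def
    by (rule sum.mono_neutral_left) (use that in \<open>auto simp: S_def in_keys_iff\<close>)
  have "Poly_Mapping.keys (bracket_types (Br j s t)) \<subseteq> S"
    using Poly_Mapping.keys_add[of "Poly_Mapping.single j 1 + bracket_types s" "bracket_types t"]
      Poly_Mapping.keys_add[of "Poly_Mapping.single j (1::nat)" "bracket_types s"]
    by (auto simp: S_def)
  moreover have "(\<Sum>i\<in>S. (Poly_Mapping.lookup (Poly_Mapping.single j 1) i) * i) = j"
    by (simp add: S_def lookup_single when_def if_distrib if_distribR sum.delta cong: if_cong)
  moreover have "Poly_Mapping.keys (bracket_types s) \<subseteq> S" "Poly_Mapping.keys (bracket_types t) \<subseteq> S"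
    by (auto simp: S_def)
  ultimately show "color_sum (Br j s t) = j + color_sum s + color_sum t"
    by (simp add: S lookup_add distrib_right sum.distrib del: One_nat_def)
qed

section \<open>Combs and the product of two bracketings\<close>

fun below :: "nat \<Rightarrow> bracketing \<Rightarrow> bool" where
  "below j (Leaf a) \<longleftrightarrow> True"
| "below j (Br d s t) \<longleftrightarrow> d < j"

fun comb :: "bracketing \<Rightarrow> bool" where
  "comb (Leaf a) \<longleftrightarrow> True"
| "comb (Br j s t) \<longleftrightarrow> comb s \<and> comb t \<and> below j t"

text \<open>
  \<open>rmul i B A\<close> is the product \<open>A \<cdot>\<^sub>i B\<close>. For \<open>B = [C, D]\<^sub>j\<close> it is \<open>[A, B]\<^sub>i\<close> when that is a comb at the root; in the
  remaining cases the Leibniz rule for \<open>i = j\<close>, respectively the mixed one for \<open>i < j\<close>, is solved for it.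
  The guard only makes termination evident: it always holds (\<open>rmul_Br_less\<close>).
\<close>

function rmul :: "nat \<Rightarrow> bracketing \<Rightarrow> bracketing \<Rightarrow> (bracketing \<Rightarrow>\<^sub>0 'k::field)" where
  "rmul i (Leaf b) A = basis_vector (Br i A (Leaf b))"
| "rmul i (Br j C D) A =
    (if j < i then basis_vector (Br i A (Br j C D))
     else if i = j then ext (rmul i D) (rmul i C A) - ext (rmul i C) (rmul i D A)
     else ext (rmul j D) (rmul i C A) - ext (rmul i C) (rmul j D A)
        + (ext (rmul i D) (rmul j C A) - ext (rmul j C) (rmul i D A))
        - ext (\<lambda>E. if size E = size (Br j C D) \<and> color_sum E < color_sum (Br j C D)
                   then rmul j E A else 0) (rmul i D C))"
  by pat_completeness auto
termination
  by (relation "measures [\<lambda>(i, B, A). size B, \<lambda>(i, B, A). color_sum B]") auto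

definition bracket_content :: "nat \<Rightarrow> bracketing \<Rightarrow> bracketing \<Rightarrow> bracketing \<Rightarrow> bool" where
  "bracket_content i A B E \<longleftrightarrow>
    mset (letters E) = mset (letters A) + mset (letters B) \<and>
    bracket_types E = Poly_Mapping.single i 1 + bracket_types A + bracket_types B \<and>
    color_sum E = i + color_sum A + color_sum B \<and>
    size E = Suc (size A + size B) \<and>
    (comb A \<longrightarrow> comb B \<longrightarrow> comb E)"

lemma keys_diff_cases:
  fixes v w :: "'a \<Rightarrow>\<^sub>0 'b::ab_group_add"
  assumes "t \<in> Poly_Mapping.keys (v - w)"
  obtains "t \<in> Poly_Mapping.keys v" | "t \<in> Poly_Mapping.keys w"
  using assms by (cases "Poly_Mapping.lookup v t = 0") (auto simp: in_keys_iff lookup_minus)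

lemma keys_add_cases:
  fixes v w :: "'a \<Rightarrow>\<^sub>0 'b::ab_group_add"
  assumes "t \<in> Poly_Mapping.keys (v + w)"
  obtains "t \<in> Poly_Mapping.keys v" | "t \<in> Poly_Mapping.keys w"
  using assms by (cases "Poly_Mapping.lookup v t = 0") (auto simp: in_keys_iff lookup_add)

lemma keys_ext_cases:
  assumes "t \<in> Poly_Mapping.keys (ext f v)"
  obtains s where "s \<in> Poly_Mapping.keys v" "t \<in> Poly_Mapping.keys (f s)"
  using assms keys_ext[of f v] by auto

text \<open>Every summand of the recursion multiplies \<open>A\<close>, \<open>C\<close>,
  \<open>D\<close> in some order, using each of the types \<open>i\<close> and \<open>j\<close>
  once, so the content is preserved. A new bracket arises only when its right argument is a leaf or
  has a smaller root type, which is exactly the comb condition at that bracket.\<close>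

lemma keys_rmul:
  "E \<in> Poly_Mapping.keys (rmul i B A :: bracketing \<Rightarrow>\<^sub>0 'k::field) \<Longrightarrow> bracket_content i A B E"
proof (induction i B A arbitrary: E rule: rmul.induct)
  case (1 i b A)
  then show ?case by (auto simp: bracket_content_def split: if_splits)
next
  case (2 i j C D A)
  show ?case
  proof (cases "j < i")
    case True
    with "2.prems" show ?thesis by (auto simp: bracket_content_def split: if_splits)
  next
    case False
    let ?K = "\<lambda>v. Poly_Mapping.keys (v :: bracketing \<Rightarrow>\<^sub>0 'k)"
    \<comment> \<open>Serves all summands of the form
      \<open>(A \<cdot>\<^sub>p X) \<cdot>\<^sub>q Z\<close>; the only other shape is
      \<open>A \<cdot>\<^sub>j (C \<cdot>\<^sub>i D)\<close>.\<close>
    have *: "bracket_content i A (Br j C D) E"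
      if "bracket_content p A X Y" "bracket_content q Y Z E"
        "p = i \<and> q = j \<or> p = j \<and> q = i" "X = C \<and> Z = D \<or> X = D \<and> Z = C" for p q X Y Z
      using that unfolding bracket_content_def by (auto simp: algebra_simps)
    have eq: ?thesis if "i = j"
    proof -
      from "2.prems" that have "E \<in> ?K (ext (rmul i D) (rmul i C A) - ext (rmul i C) (rmul i D A))"
        by simp
      then consider
          X where "X \<in> ?K (rmul i C A)" "E \<in> ?K (rmul i D X)"
        | X where "X \<in> ?K (rmul i D A)" "E \<in> ?K (rmul i C X)"
        by (elim keys_diff_cases keys_ext_cases) blast+
      then show ?thesis
      proof cases
        case (1 X)
        show ?thesis
          by (rule *[OF "2.IH"(3)[OF False that 1(1)] "2.IH"(1)[OF False that 1(2)]]) (use that in auto)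
      next
        case (2 X)
        show ?thesis
          by (rule *[OF "2.IH"(1)[OF False that 2(1)] "2.IH"(3)[OF False that 2(2)]]) (use that in auto)
      qed
    qed
    have "?thesis" if "i \<noteq> j"
    proof -
      let ?f = "\<lambda>E. if size E = size (Br j C D) \<and> color_sum E < color_sum (Br j C D)
                   then rmul j E A else (0 :: bracketing \<Rightarrow>\<^sub>0 'k)"
      from "2.prems" that False have "E \<in> ?K (ext (rmul j D) (rmul i C A) - ext (rmul i C) (rmul j D A)
        + (ext (rmul i D) (rmul j C A) - ext (rmul j C) (rmul i D A)) - ext ?f (rmul i D C))"
        by simp
      then consider
          X where "X \<in> ?K (rmul i C A)" "E \<in> ?K (rmul j D X)"
        | X where "X \<in> ?K (rmul j D A)" "E \<in> ?K (rmul i C X)"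
        | X where "X \<in> ?K (rmul j C A)" "E \<in> ?K (rmul i D X)"
        | X where "X \<in> ?K (rmul i D A)" "E \<in> ?K (rmul j C X)"
        | X where "X \<in> ?K (rmul i D C)" "E \<in> ?K (?f X)"
        by (elim keys_diff_cases keys_add_cases keys_ext_cases) blast+
      then show ?thesis
      proof cases
        case (1 X)
        show ?thesis
          by (rule *[OF "2.IH"(7)[OF False that 1(1)] "2.IH"(5)[OF False that 1(2)]]) auto
      next
        case (2 X)
        show ?thesis
          by (rule *[OF "2.IH"(5)[OF False that 2(1)] "2.IH"(7)[OF False that 2(2)]]) auto
      next
        case (3 X)
        show ?thesis
          by (rule *[OF "2.IH"(11)[OF False that 3(1)] "2.IH"(9)[OF False that 3(2)]]) auto
      next
        case (4 X)
        show ?thesis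
          by (rule *[OF "2.IH"(9)[OF False that 4(1)] "2.IH"(11)[OF False that 4(2)]]) auto
      next
        case (5 X)
        then have X: "E \<in> ?K (rmul j X A)" "size X = size (Br j C D) \<and> color_sum X < color_sum (Br j C D)"
          by (auto split: if_splits)
        show ?thesis
          using "2.IH"(14)[OF False that 5(1)] "2.IH"(13)[OF False that X(2,1)] False
          unfolding bracket_content_def by (auto simp: algebra_simps)
      qed
    qed
    with eq show ?thesis by blast
  qed
qed

lemma rmul_Br_less:
  assumes "i < j"
  shows "rmul i (Br j C D) A = ext (rmul j D) (rmul i C A) - ext (rmul i C) (rmul j D A)
        + (ext (rmul i D) (rmul j C A) - ext (rmul j C) (rmul i D A))
        - (ext (\<lambda>E. rmul j E A) (rmul i D C) :: bracketing \<Rightarrow>\<^sub>0 'k::field)"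
proof -
  have "ext (\<lambda>E. if size E = size (Br j C D) \<and> color_sum E < color_sum (Br j C D)
                   then rmul j E A else 0) (rmul i D C) = ext (\<lambda>E. rmul j E A) (rmul i D C :: bracketing \<Rightarrow>\<^sub>0 'k)"
    by (rule ext_cong) (use assms in \<open>auto dest!: keys_rmul simp: bracket_content_def\<close>)
  with assms show ?thesis by simp
qed

lemma rmul_below: "below i B \<Longrightarrow> rmul i B A = basis_vector (Br i A B)"
  by (cases B) auto

declare rmul.simps [simp del]

text \<open>Here the factors stand in their natural order; \<open>rmul\<close> takes the right
  factor first because its recursion runs over that factor.\<close>

definition mul :: "nat \<Rightarrow> (bracketing \<Rightarrow>\<^sub>0 'k::field) \<Rightarrow> (bracketing \<Rightarrow>\<^sub>0 'k) \<Rightarrow> (bracketing \<Rightarrow>\<^sub>0 'k)"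
  where "mul i u v = ext (\<lambda>B. ext (rmul i B) u) v"

lemma mul_linear:
  "mul i (u + u') v = mul i u v + mul i u' v"
  "mul i u (v + v') = mul i u v + mul i u v'"
  "mul i (u - u') v = mul i u v - mul i u' v"
  "mul i u (v - v') = mul i u v - mul i u v'"
  "mul i (- u) v = - mul i u v"
  "mul i u (- v) = - mul i u v"
  "mul i 0 v = 0"
  "mul i u 0 = 0"
proof -
  show a: "mul i (u + u') v = mul i u v + mul i u' v" for u u'
    by (simp add: mul_def ext_add ext_fun_add)
  show d: "mul i (u - u') v = mul i u v - mul i u' v" for u u'
    by (simp add: mul_def ext_diff ext_fun_diff)
  show z: "mul i 0 v = 0"
    by (simp add: mul_def ext_fun_zero)
  show "mul i (- u) v = - mul i u v"
    using d[of 0 u] by (simp add: z)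
qed (simp_all add: mul_def ext_add ext_diff ext_uminus)

lemma mul_basis [simp]: "mul i (basis_vector A) (basis_vector B) = rmul i B A"
  by (simp add: mul_def)

text \<open>The defect of the right Leibniz rule \<open>a(cd) = (ac)d - (ad)c\<close>, with type
  \<open>i\<close> for the product formed with \<open>a\<close> and type \<open>j\<close> for the
  one formed with \<open>c\<close> or \<open>d\<close>.\<close>

definition leib :: "nat \<Rightarrow> nat \<Rightarrow> (bracketing \<Rightarrow>\<^sub>0 'k::field) \<Rightarrow> (bracketing \<Rightarrow>\<^sub>0 'k) \<Rightarrow> (bracketing \<Rightarrow>\<^sub>0 'k) \<Rightarrow> (bracketing \<Rightarrow>\<^sub>0 'k)"
  where "leib i j a c d = mul i a (mul j c d) - mul j (mul i a c) d + mul j (mul i a d) c"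

text \<open>The coefficient of \<lambda>_i \<lambda>_j in the Leibniz defect of the generic product
  with coefficients \<lambda>_i. Its vanishing for all \<open>i\<close>, \<open>j\<close> is the
  Leibniz rule for all linear combinations of the products.\<close>

definition leib2 :: "nat \<Rightarrow> nat \<Rightarrow> (bracketing \<Rightarrow>\<^sub>0 'k::field) \<Rightarrow> (bracketing \<Rightarrow>\<^sub>0 'k) \<Rightarrow> (bracketing \<Rightarrow>\<^sub>0 'k) \<Rightarrow> (bracketing \<Rightarrow>\<^sub>0 'k)"
  where "leib2 i j a c d = (if i = j then leib i i a c d else leib i j a c d + leib j i a c d)"

lemma leib2_commute: "leib2 i j a c d = leib2 j i a c d"
  by (simp add: leib2_def add.commute)

lemma leib2_add:
  "leib2 i j (a + a') c d = leib2 i j a c d + leib2 i j a' c d"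
  "leib2 i j a (c + c') d = leib2 i j a c d + leib2 i j a c' d"
  "leib2 i j a c (d + d') = leib2 i j a c d + leib2 i j a c d'"
  by (simp_all add: leib2_def leib_def mul_linear)

text \<open>Every summand contains one defect whose last argument is \<open>e\<close> or
  \<open>f\<close>, so these terms are controlled once the Leibniz rule is known for
  \<open>e\<close> and for \<open>f\<close> in the last place.\<close>

definition cubic_rest where
  "cubic_rest p q r a c e f =
     mul p a (leib q r c e f) + leib p r a (mul q c e) f - leib p r a (mul q c f) e
   + mul r (leib p q a c e) f - leib r q (mul p a f) c e - mul r (leib p q a c f) e
   + leib r q (mul p a e) c f - leib q r (mul p a c) e f + mul q (leib p r a e f) c"

definition quartic_rest where
  "quartic_rest p q r a c e f =
     mul q (mul r (mul p a e) c) f - mul r (mul q (mul p a e) c) f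
   + mul r (mul q (mul p a f) c) e - mul q (mul r (mul p a f) c) e"

text \<open>
  The terms of \<open>quartic_rest\<close> change sign under exchanging \<open>q\<close> and \<open>r\<close>, so they disappear once the
  defect is summed over all orders of the three types.
\<close>

lemma leib_mul:
  "leib p q a c (mul r e f) = cubic_rest p q r a c e f + quartic_rest p q r a c e f"
  by (simp add: leib_def cubic_rest_def quartic_rest_def mul_linear)

text \<open>Polarization: the coefficient of \<lambda>_i \<lambda>_j \<lambda>_d in the generic
  Leibniz defect at a product of \<open>e\<close> and \<open>f\<close> vanishes by
  \<open>leib_mul\<close>. In that coefficient, all summands other than the desired one have a type
  smaller than \<open>d\<close> at the product of \<open>e\<close> and \<open>f\<close>, and
  \<open>lower\<close> removes them.\<close>

lemma leib2_mul_eq_0: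
  assumes e: "\<And>p q a c. leib2 p q a c e = 0" and f: "\<And>p q a c. leib2 p q a c f = 0"
    and "i \<le> j" "j \<le> d"
    and lower: "\<And>p q m. m < d \<Longrightarrow> leib2 p q a c (mul m e f) = 0"
  shows "leib2 i j a c (mul d e f) = 0"
proof -
  \<comment> \<open>Together with \<open>swap\<close>: with last argument \<open>e\<close> or
    \<open>f\<close>, the defect is alternating in its two types.\<close>
  have same: "leib p p x y e = 0" "leib p p x y f = 0" for p x y
    using e[of p p x y] f[of p p x y] by (simp_all add: leib2_def)
  have swap: "leib q p x y e = - leib p q x y e" "leib q p x y f = - leib p q x y f" if "p < q" for p q x y
    using e[of p q x y] f[of p q x y] that
    by (simp_all add: leib2_def eq_neg_iff_add_eq_0 add.commute)
  note rest = cubic_rest_def quartic_rest_def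
  consider "i < j" "j < d" | "i < j" "j = d" | "i = j" "j < d" | "i = j" "j = d"
    using assms(3,4) by linarith
  then show ?thesis
  proof cases
    case 1
    \<comment> \<open>The added terms are zero by \<open>lower\<close>; they complete the sum over
      all six orders of the three types. The next two cases are the analogous sums for a repeated
      type.\<close>
    then have "leib2 i j a c (mul d e f) = leib2 i j a c (mul d e f)
        + leib2 i d a c (mul j e f) + leib2 j d a c (mul i e f)"
      by (simp add: lower)
    also have "\<dots> = 0"
      using 1 by (simp add: leib2_def leib_mul rest same mul_linear
          swap[of i j] swap[of i d] swap[of j d])
    finally show ?thesis .
  next
    case 2
    then have "leib2 i j a c (mul d e f) = leib2 i d a c (mul d e f) + leib2 d d a c (mul i e f)"
      by (simp add: lower)
    also have "\<dots> = 0"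
      using 2 by (simp add: leib2_def leib_mul rest same mul_linear swap[of i j] swap[of i d] swap[of j d])
    finally show ?thesis .
  next
    case 3
    then have "leib2 i j a c (mul d e f) = leib2 i i a c (mul d e f) + leib2 i d a c (mul i e f)"
      by (simp add: lower)
    also have "\<dots> = 0"
      using 3 by (simp add: leib2_def leib_mul rest same mul_linear swap[of i j] swap[of i d] swap[of j d])
    finally show ?thesis .
  next
    case 4
    then show ?thesis
      by (simp add: leib2_def leib_mul rest same mul_linear)
  qed
qed

lemma mul_scale:
  "mul i (free_scale s u) v = free_scale s (mul i u v)"
  "mul i u (free_scale s v) = free_scale s (mul i u v)"
proof -
  show "mul i (free_scale s u) v = free_scale s (mul i u v)"
    unfolding mul_def ext_scale
    by (simp add: ext_def free.scale_sum_right mult_ac)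
qed (simp add: mul_def ext_scale)

lemma leib2_scale:
  "leib2 i j (free_scale s a) c d = free_scale s (leib2 i j a c d)"
  "leib2 i j a (free_scale s c) d = free_scale s (leib2 i j a c d)"
  "leib2 i j a c (free_scale s d) = free_scale s (leib2 i j a c d)"
  by (simp_all add: leib2_def leib_def mul_scale free.scale_right_distrib free.scale_right_diff_distrib)

lemma additive_eq_0:
  fixes h :: "(bracketing \<Rightarrow>\<^sub>0 'k::field) \<Rightarrow> (bracketing \<Rightarrow>\<^sub>0 'k)"
  assumes "\<And>u v. h (u + v) = h u + h v" "\<And>s v. h (free_scale s v) = free_scale s (h v)"
    and "\<And>t. t \<in> Poly_Mapping.keys v \<Longrightarrow> h (basis_vector t) = 0"
  shows "h v = 0"
proof -
  have 0: "h 0 = 0" using assms(2)[of 0 0] by simp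
  have "h (\<Sum>t\<in>S. free_scale (Poly_Mapping.lookup v t) (basis_vector t)) = 0"
    if "finite S" "S \<subseteq> Poly_Mapping.keys v" for S
    using that by (induction S) (auto simp: 0 assms)
  from this[of "Poly_Mapping.keys v"] show ?thesis
    by (simp flip: ext_def)
qed

text \<open>By symmetry let \<open>i \<le> j\<close>. If \<open>[C, D]\<^sub>j\<close> satisfies the
  comb condition at its root, then the identity is the recursion that defines
  \<open>A \<cdot>\<^sub>i [C, D]\<^sub>j\<close>. Otherwise \<open>D\<close> is itself a product
  \<open>E \<cdot>\<^sub>d F\<close> with \<open>j \<le> d\<close>, and
  \<open>leib2_mul_eq_0\<close> reduces the claim to smaller combs.\<close>

lemma leib2_eq_0_comb:
  fixes a c :: "bracketing \<Rightarrow>\<^sub>0 'k::field"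
  shows "comb D \<Longrightarrow> leib2 i j a c (basis_vector D) = 0"
proof (induction D arbitrary: i j a c rule: wf_induct[where r = "measures [size, color_sum]"])
  case 1
  show ?case by simp
next
  case (2 D)
  have IH: "leib2 i j a c (basis_vector E) = 0"
    if "comb E" "size E < size D \<or> size E = size D \<and> color_sum E < color_sum D" for E i j and a c :: "bracketing \<Rightarrow>\<^sub>0 'k"
    using 2 that by auto
  have *: "leib2 i j a c (basis_vector D) = 0" if "i \<le> j" for i j and a c :: "bracketing \<Rightarrow>\<^sub>0 'k"
  proof (cases "below j D")
    case True
    \<comment> \<open>Here \<open>C \<cdot>\<^sub>j D\<close> is a single bracketing; for
      \<open>i < j\<close>, the term \<open>C \<cdot>\<^sub>i D\<close> may still be a sum, which
      the last summand of \<open>rmul_Br_less\<close> matches.\<close>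
    have "leib2 i j (basis_vector A) (basis_vector C) (basis_vector D) = (0 :: bracketing \<Rightarrow>\<^sub>0 'k)" for A C
    proof -
      have s: "mul j (basis_vector C) (basis_vector D) = (basis_vector (Br j C D) :: bracketing \<Rightarrow>\<^sub>0 'k)"
        using True by (simp add: rmul_below)
      have m: "mul i v (basis_vector B) = ext (rmul i B) v" for i B and v :: "bracketing \<Rightarrow>\<^sub>0 'k"
        by (simp add: mul_def)
      have m2: "mul j (basis_vector A) v = ext (\<lambda>E. rmul j E A) v" for v :: "bracketing \<Rightarrow>\<^sub>0 'k"
        by (simp add: mul_def)
      show ?thesis
      proof (cases "i = j")
        case True
        have t: "mul i (basis_vector A) (basis_vector (Br i C D)) =
            ext (rmul i D) (rmul i C A) - ext (rmul i C) (rmul i D A :: bracketing \<Rightarrow>\<^sub>0 'k)"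
          unfolding mul_basis by (subst rmul.simps(2)) simp
        have "leib2 i i (basis_vector A) (basis_vector C) (basis_vector D) = (0 :: bracketing \<Rightarrow>\<^sub>0 'k)"
          unfolding leib2_def leib_def s[folded True] t by (simp add: m del: mul_basis)
        then show ?thesis by (simp add: True)
      next
        case False
        with that have "i < j" by simp
        then show ?thesis unfolding leib2_def leib_def s
          by (simp add: m m2 rmul_Br_less)
      qed
    qed
    note base = this
    have "leib2 i j a (basis_vector C) (basis_vector D) = 0" for C
      by (rule additive_eq_0[of "\<lambda>a. leib2 i j a (basis_vector C) (basis_vector D)"])
        (simp_all add: leib2_add leib2_scale base)
    note base = this
    show ?thesis
      by (rule additive_eq_0[of "\<lambda>c. leib2 i j a c (basis_vector D)"])
        (simp_all add: leib2_add leib2_scale base)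
  next
    case False
    then obtain d E F where D: "D = Br d E F" and d: "j \<le> d"
      by (cases D) auto
    with 2 have c: "comb E" "comb F" "below d F" by auto
    have eq: "mul d (basis_vector E) (basis_vector F) = (basis_vector D :: bracketing \<Rightarrow>\<^sub>0 'k)"
      using c by (simp add: D rmul_below)
    have EF: "leib2 p q a c (basis_vector E) = 0" "leib2 p q a c (basis_vector F) = 0"
      for p q and a c :: "bracketing \<Rightarrow>\<^sub>0 'k"
      by (rule IH; use c in \<open>simp add: D\<close>)+
    \<comment> \<open>The bracketings in \<open>E \<cdot>\<^sub>m F\<close> are combs of the size of
      \<open>D\<close> with smaller color sum, so the induction hypothesis covers them although they
      are no smaller in size.\<close>
    have lower: "leib2 p q a c (mul m (basis_vector E) (basis_vector F)) = 0" if "m < d"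
      for p q m and a c :: "bracketing \<Rightarrow>\<^sub>0 'k"
    proof (rule additive_eq_0[of "\<lambda>v. leib2 p q a c v"])
      fix t assume "t \<in> Poly_Mapping.keys (mul m (basis_vector E) (basis_vector F) :: bracketing \<Rightarrow>\<^sub>0 'k)"
      then have "bracket_content m E F t" by (simp add: keys_rmul)
      with c that show "leib2 p q a c (basis_vector t) = 0"
        by (intro IH) (simp_all add: D bracket_content_def)
    qed (simp_all add: leib2_add leib2_scale)
    show ?thesis
      unfolding eq[symmetric] by (rule leib2_mul_eq_0[OF EF that d lower])
  qed
  show ?case
  proof (cases "i \<le> j")
    case False
    then have "leib2 j i a c (basis_vector D) = 0" by (intro *) simp
    then show ?thesis by (simp add: leib2_commute[of i j])
  qed (rule *)
qed

lemma leib2_eq_0: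
  assumes "\<And>D. D \<in> Poly_Mapping.keys d \<Longrightarrow> comb D"
  shows "leib2 i j a c d = 0"
  by (rule additive_eq_0[of "\<lambda>d. leib2 i j a c d"])
    (auto simp: leib2_add leib2_scale intro!: leib2_eq_0_comb assms)

section \<open>Evaluation of bracketings\<close>

definition min_letter :: "bracketing \<Rightarrow> nat"
  where "min_letter t = Min (set (letters t))"

lemma letters_nonempty [simp]: "letters t \<noteq> []"
  by (induction t) auto

lemma min_letter_in: "min_letter t \<in> set (letters t)"
  unfolding min_letter_def by (intro Min_in) auto

lemma min_letter_simps [simp]:
  "min_letter (Leaf a) = a"
  "min_letter (Br j s t) = min (min_letter s) (min_letter t)"
  by (simp_all add: min_letter_def Min_Un)

fun letter_normal :: "bracketing \<Rightarrow> bool" where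
  "letter_normal (Leaf a) \<longleftrightarrow> True"
| "letter_normal (Br j s t) \<longleftrightarrow> letter_normal s \<and> letter_normal t \<and> min_letter s < min_letter t"

text \<open>A right Leibniz product alone is not antisymmetric; the least letters decide which
  factor goes left, and the sign makes the result antisymmetric.\<close>

fun eval_br :: "bracketing \<Rightarrow> (bracketing \<Rightarrow>\<^sub>0 'k::field)" where
  "eval_br (Leaf a) = basis_vector (Leaf a)"
| "eval_br (Br i s t) =
    (if min_letter s < min_letter t then mul i (eval_br s) (eval_br t) else - mul i (eval_br t) (eval_br s))"

lemma eval_br_normal: "comb t \<Longrightarrow> letter_normal t \<Longrightarrow> eval_br t = basis_vector t"
  by (induction t) (auto simp: rmul_below)

lemma keys_mul_comb:
  assumes "\<And>t. t \<in> Poly_Mapping.keys u \<Longrightarrow> comb t" "\<And>t. t \<in> Poly_Mapping.keys v \<Longrightarrow> comb t"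
    and "t \<in> Poly_Mapping.keys (mul i u v)"
  shows "comb t"
  using assms(3) unfolding mul_def
  by (elim keys_ext_cases) (use assms(1,2) in \<open>auto dest!: keys_rmul simp: bracket_content_def\<close>)

lemma keys_eval_br_comb: "s \<in> Poly_Mapping.keys (eval_br t) \<Longrightarrow> comb s"
proof (induction t arbitrary: s)
  case (Br i t u)
  then show ?case by (auto split: if_splits elim: keys_mul_comb[rotated 2])
qed simp

lemma leib2_eval: "leib2 i j a c (eval_br t) = 0"
  by (rule leib2_eq_0) (rule keys_eval_br_comb)

lemma eval_antisymmetry:
  assumes "distinct (letters (Br j x y))"
  shows "eval_br (Br j x y) + eval_br (Br j y x) = 0"
proof -
  have "min_letter x \<noteq> min_letter y"
    using assms min_letter_in[of x] min_letter_in[of y] by auto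
  then show ?thesis by auto
qed


text \<open>The Jacobi sum is invariant under cyclic rotation, so \<open>x\<close> may be taken to
  contain the least letter. Then \<open>x\<close> is always the leftmost factor and the sum is
  \<open>leib2\<close> up to a sign fixed by the order of \<open>y\<close> and \<open>z\<close>. For
  distinct types only the sum of both type orders has this form, since \<open>T i j\<close> mixes
  terms of \<open>leib i j\<close> and \<open>leib j i\<close>.\<close>

lemma eval_jacobi_sum:
  assumes "distinct (letters (Br i x (Br j y z)))"
  defines "T \<equiv> \<lambda>i j. eval_br (Br i x (Br j y z)) + eval_br (Br i z (Br j x y)) + (eval_br (Br i y (Br j z x)) :: bracketing \<Rightarrow>\<^sub>0 'k::field)"
  shows "(if i = j then T i i else T i j + T j i) = 0"
proof -
  define S where "S x y z i j = eval_br (Br i x (Br j y z)) + eval_br (Br i z (Br j x y)) + (eval_br (Br i y (Br j z x)) :: bracketing \<Rightarrow>\<^sub>0 'k)"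
    for x y z i j
  have *: "(if i = j then S x y z i i else S x y z i j + S x y z j i) = 0"
    if "min_letter x < min_letter y" "min_letter x < min_letter z" "min_letter y \<noteq> min_letter z" for x y z
  proof (cases "min_letter y < min_letter z")
    case True
    then have "(if i = j then S x y z i i else S x y z i j + S x y z j i) = leib2 i j (eval_br x) (eval_br y) (eval_br z)"
      using that by (auto simp: S_def leib2_def leib_def mul_linear algebra_simps)
    then show ?thesis by (simp add: leib2_eval)
  next
    case False
    then have "(if i = j then S x y z i i else S x y z i j + S x y z j i) = - leib2 i j (eval_br x) (eval_br z) (eval_br y)"
      using that by (auto simp: S_def leib2_def leib_def mul_linear algebra_simps)
    then show ?thesis by (simp add: leib2_eval)
  qed
  have rot: "S x y z = S y z x" for x y z
    by (intro ext) (simp only: S_def add_ac)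
  have d: "min_letter x \<noteq> min_letter y" "min_letter x \<noteq> min_letter z" "min_letter y \<noteq> min_letter z"
    using assms(1) min_letter_in[of x] min_letter_in[of y] min_letter_in[of z] by auto
  then consider "min_letter x < min_letter y" "min_letter x < min_letter z"
    | "min_letter y < min_letter x" "min_letter y < min_letter z"
    | "min_letter z < min_letter y" "min_letter z < min_letter x"
    by linarith
  then have "(if i = j then S x y z i i else S x y z i j + S x y z j i) = 0"
  proof cases
    case 1
    then show ?thesis using * d by blast
  next
    case 2
    then show ?thesis using *[of y z x] d unfolding rot[of x y z] by auto
  next
    case 3
    then show ?thesis using *[of z x y] d unfolding rot[of z x y] by auto
  qed
  then show ?thesis
    by (simp only: S_def T_def)
qed

lemma min_letter_plug: "min_letter u = min_letter v \<Longrightarrow> min_letter (plug C u) = min_letter (plug C v)"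
  by (induction C) auto

text \<open>Because all terms have the same least letter, they fall into the same case of
  \<open>eval_br\<close> at every bracket above the hole, so the context acts on them linearly.
  Lists allow relations with two, three and six terms to be treated alike.\<close>

lemma eval_plug_sum:
  assumes "\<And>u. u \<in> set us \<Longrightarrow> min_letter u = m"
    and "(\<Sum>u\<leftarrow>us. eval_br u) = (0 :: bracketing \<Rightarrow>\<^sub>0 'k::field)"
  shows "(\<Sum>u\<leftarrow>us. eval_br (plug C u)) = (0 :: bracketing \<Rightarrow>\<^sub>0 'k)"
proof (cases us)
  case (Cons u0 us')
  have min: "min_letter (plug D u) = min_letter (plug D u0)" if "u \<in> set us" for u D
    by (rule min_letter_plug) (use assms(1) that Cons in auto)
  have mul_sum: "(\<Sum>u\<leftarrow>us. mul i (f u) v) = mul i (\<Sum>u\<leftarrow>us. f u) v"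
    "(\<Sum>u\<leftarrow>us. mul i v (f u)) = mul i v (\<Sum>u\<leftarrow>us. f u)"
    "(\<Sum>u\<leftarrow>us. - f u) = - (\<Sum>u\<leftarrow>us. f u)"
    for f :: "bracketing \<Rightarrow> (bracketing \<Rightarrow>\<^sub>0 'k)" and us i v
    by (induction us) (simp_all add: mul_linear)
  show ?thesis
  proof (induction C)
    case Hole
    then show ?case using assms(2) by simp
  next
    case (InLeft j C t)
    have "(\<Sum>u\<leftarrow>us. eval_br (plug (InLeft j C t) u)) =
        (\<Sum>u\<leftarrow>us. if min_letter (plug C u0) < min_letter t then mul j (eval_br (plug C u)) (eval_br t)
                else - mul j (eval_br t) (eval_br (plug C u)) :: bracketing \<Rightarrow>\<^sub>0 'k)"
      by (intro arg_cong[where f = sum_list] map_cong) (use min[of _ C] in auto)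
    then show ?case using InLeft
      by (cases "min_letter (plug C u0) < min_letter t") (simp_all add: mul_sum mul_linear del: eval_br.simps plug.simps)
  next
    case (InRight j s C)
    have "(\<Sum>u\<leftarrow>us. eval_br (plug (InRight j s C) u)) =
        (\<Sum>u\<leftarrow>us. if min_letter s < min_letter (plug C u0) then mul j (eval_br s) (eval_br (plug C u))
                else - mul j (eval_br (plug C u)) (eval_br s) :: bracketing \<Rightarrow>\<^sub>0 'k)"
      by (intro arg_cong[where f = sum_list] map_cong) (use min[of _ C] in auto)
    then show ?case using InRight
      by (cases "min_letter s < min_letter (plug C u0)") (simp_all add: mul_sum mul_linear del: eval_br.simps plug.simps)
  qed
qed simp

lemma distinct_letters_plug: "distinct (letters (plug C u)) \<Longrightarrow> distinct (letters u)"
  by (induction C) auto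

lemma ext_eval_relation: "v \<in> lie_relations n \<Longrightarrow> ext eval_br v = 0"
proof (induction rule: lie_relations.induct)
  case (antisymmetry C j x y)
  then have "distinct (letters (Br j x y))"
    by - (rule distinct_letters_plug[of C], simp add: bracketed_permutation_def)
  from eval_antisymmetry[OF this]
  have "(\<Sum>u\<leftarrow>[Br j x y, Br j y x]. eval_br u) = (0 :: bracketing \<Rightarrow>\<^sub>0 'a)"
    by simp
  then have "(\<Sum>u\<leftarrow>[Br j x y, Br j y x]. eval_br (plug C u)) = (0 :: bracketing \<Rightarrow>\<^sub>0 'a)"
    by (intro eval_plug_sum[where m = "min_letter (Br j x y)"]) auto
  then show ?case by (simp add: ext_add del: eval_br.simps)
next
  case (jacobi C j x y z)
  then have "distinct (letters (Br j x (Br j y z)))"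
    by - (rule distinct_letters_plug[of C], simp add: bracketed_permutation_def)
  from eval_jacobi_sum[OF this]
  have "(\<Sum>u\<leftarrow>[Br j x (Br j y z), Br j z (Br j x y), Br j y (Br j z x)]. eval_br u) = (0 :: bracketing \<Rightarrow>\<^sub>0 'a)"
    by (simp add: add_ac del: eval_br.simps)
  then have "(\<Sum>u\<leftarrow>[Br j x (Br j y z), Br j z (Br j x y), Br j y (Br j z x)]. eval_br (plug C u)) = (0 :: bracketing \<Rightarrow>\<^sub>0 'a)"
    by (intro eval_plug_sum[where m = "min_letter (Br j x (Br j y z))"]) (auto simp: min.assoc min.commute min.left_commute)
  then show ?case by (simp add: ext_add add_ac del: eval_br.simps)
next
  case (mixed_jacobi C i x j y z)
  let ?us = "[Br i x (Br j y z), Br i z (Br j x y), Br i y (Br j z x), Br j x (Br i y z), Br j z (Br i x y), Br j y (Br i z x)]"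
  from mixed_jacobi have "distinct (letters (Br i x (Br j y z)))"
    by - (rule distinct_letters_plug[of C], simp add: bracketed_permutation_def)
  from eval_jacobi_sum[OF this] mixed_jacobi(2)
  have "(\<Sum>u\<leftarrow>?us. eval_br u) = (0 :: bracketing \<Rightarrow>\<^sub>0 'a)"
    by (simp add: add_ac del: eval_br.simps)
  then have "(\<Sum>u\<leftarrow>?us. eval_br (plug C u)) = (0 :: bracketing \<Rightarrow>\<^sub>0 'a)"
    by (intro eval_plug_sum[where m = "min_letter (Br i x (Br j y z))"]) (auto simp: min.assoc min.commute min.left_commute)
  then show ?case by (simp add: ext_add add_ac del: eval_br.simps)
qed

lemma ext_eval_relation_space: "v \<in> relation_space \<Longrightarrow> ext eval_br v = 0"
proof -
  have "free.span (\<Union>n. lie_relations n) \<subseteq> {v. ext eval_br v = 0}"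
    by (rule free.span_minimal) (auto simp: ext_eval_relation free.subspace_def ext_add ext_scale)
  then show "v \<in> relation_space \<Longrightarrow> ext eval_br v = 0"
    by (auto simp: relation_space_def)
qed

section \<open>Evaluation on the quotient and independence of the colored combs\<close>

lift_definition lie_eval :: "'k::field lie \<Rightarrow> (bracketing \<Rightarrow>\<^sub>0 'k)" is "ext eval_br"
  using ext_eval_relation_space by (fastforce simp: ext_diff)

lemma lie_eval_simps [simp]:
  "lie_eval (x + y) = lie_eval x + lie_eval y"
  "lie_eval (lie_scale c x) = free_scale c (lie_eval x)"
  "lie_eval 0 = 0"
  "lie_eval (lie_class t) = eval_br t"
  by (transfer; simp add: ext_add ext_scale)+

lemma lie_eval_sum: "lie_eval (sum f A) = (\<Sum>x\<in>A. lie_eval (f x))"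
  by (induction A rule: infinite_finite_induct) auto

definition colored_comb :: "bracketing \<Rightarrow> bool"
  where "colored_comb t \<longleftrightarrow> comb t \<and> letter_normal t"

lemma lie_eval_colored_comb: "colored_comb t \<Longrightarrow> lie_eval (lie_class t) = basis_vector t"
  by (simp add: colored_comb_def eval_br_normal)

lemma inj_on_lie_class: "inj_on (lie_class :: _ \<Rightarrow> 'k::field lie) {t. colored_comb t}"
proof (rule inj_onI)
  fix s t assume st: "s \<in> {t. colored_comb t}" "t \<in> {t. colored_comb t}"
    and "lie_class s = (lie_class t :: 'k lie)"
  then have "basis_vector s = (basis_vector t :: bracketing \<Rightarrow>\<^sub>0 'k)"
    by (metis lie_eval_colored_comb mem_Collect_eq)
  then have "Poly_Mapping.lookup (basis_vector s) s = Poly_Mapping.lookup (basis_vector t :: bracketing \<Rightarrow>\<^sub>0 'k) s"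
    by simp
  then show "s = t"
    by (simp add: lookup_single when_def split: if_splits)
qed

text \<open>\<open>lie_eval\<close> sends the class of a colored comb back to its basis vector, so
  reading off one coefficient of the image of a vanishing combination isolates one scalar.\<close>

lemma independent_colored_combs:
  assumes "S \<subseteq> {t. colored_comb t}"
  shows "lie.independent (lie_class ` S :: 'k::field lie set)"
  unfolding lie.independent_explicit_module
proof (intro allI impI)
  fix T u v
  assume T: "finite T" "T \<subseteq> lie_class ` S" "(\<Sum>v\<in>T. lie_scale (u v) v) = 0" and v: "v \<in> (T :: 'k lie set)"
  from T(2) v obtain t where t: "t \<in> S" "v = lie_class t" by auto
  have "0 = Poly_Mapping.lookup (lie_eval (\<Sum>v\<in>T. lie_scale (u v) v)) t"
    using T by simp
  also have "\<dots> = (\<Sum>w\<in>T. u w * Poly_Mapping.lookup (lie_eval w) t)"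
    by (simp add: lie_eval_sum lookup_sum)
  also have "\<dots> = (\<Sum>w\<in>T. if w = v then u w else 0)"
  proof (rule sum.cong)
    fix w assume "w \<in> T"
    with T(2) obtain s where "s \<in> S" "w = lie_class s" by auto
    with t assms show "u w * Poly_Mapping.lookup (lie_eval w) t = (if w = v then u w else 0)"
      using inj_onD[OF inj_on_lie_class, of s t]
      by (auto simp: lie_eval_colored_comb subset_iff lookup_single when_def simp del: lie_eval_simps(4))
  qed simp
  also have "\<dots> = u v"
    using T(1) v by simp
  finally show "u v = 0" by simp
qed

section \<open>Straightening\<close>

fun compose :: "bracketing_context \<Rightarrow> bracketing_context \<Rightarrow> bracketing_context" where
  "compose Hole D = D"
| "compose (InLeft j C t) D = InLeft j (compose C D) t"
| "compose (InRight j s C) D = InRight j s (compose C D)"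

lemma plug_compose: "plug (compose C D) u = plug C (plug D u)"
  by (induction C) auto

lemma bracketed_permutation_iff: "bracketed_permutation n t \<longleftrightarrow> mset (letters t) = mset_set {1..n}"
proof
  assume "bracketed_permutation n t"
  then show "mset (letters t) = mset_set {1..n}"
    by (metis bracketed_permutation_def mset_set_set)
next
  assume *: "mset (letters t) = mset_set {1..n}"
  then have "set (letters t) = {1..n}"
    by (metis finite_atLeastAtMost finite_set_mset_mset_set set_mset_mset)
  moreover from this * have "distinct (letters t)"
    by (metis card_atLeastAtMost card_distinct size_mset size_mset_set)
  ultimately show "bracketed_permutation n t"
    by (simp add: bracketed_permutation_def)
qed

lemma mset_letters_plug:
  "mset (letters u) = mset (letters v) \<Longrightarrow> mset (letters (plug C u)) = mset (letters (plug C v))"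
  by (induction C) auto

lemma bracketed_permutation_plug_cong:
  "bracketed_permutation n (plug C u) \<Longrightarrow> mset (letters u) = mset (letters v) \<Longrightarrow>
    bracketed_permutation n (plug C v)"
  using mset_letters_plug[of u v C] by (simp add: bracketed_permutation_iff)

lemma min_letter_mset_cong: "mset (letters u) = mset (letters v) \<Longrightarrow> min_letter u = min_letter v"
  by (metis min_letter_def set_mset_mset)

lemma length_letters: "length (letters t) = Suc (size t)"
  by (induction t) auto

lemma relation_space_generator: "v \<in> lie_relations n \<Longrightarrow> v \<in> relation_space"
  unfolding relation_space_def by (intro free.span_base) auto

lemma abs_lie_eq_0: "v \<in> relation_space \<Longrightarrow> abs_lie v = 0"
  by (simp add: zero_lie_def lie.abs_eq_iff)

lemma lie_class_add_abs:
  "lie_class s + lie_class t = abs_lie (basis_vector s + basis_vector t)"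
  "abs_lie v + lie_class t = abs_lie (v + basis_vector t)"
  by (simp_all add: lie_class.abs_eq plus_lie.abs_eq)

lemma lie_antisymmetry:
  assumes "bracketed_permutation n (plug C (Br j x y))"
  shows "lie_class (plug C (Br j x y)) = - (lie_class (plug C (Br j y x)) :: 'k::field lie)"
proof -
  have "lie_class (plug C (Br j x y)) + lie_class (plug C (Br j y x)) = (0 :: 'k lie)"
  proof -
    have "basis_vector (plug C (Br j x y)) + basis_vector (plug C (Br j y x)) \<in> (relation_space :: (_ \<Rightarrow>\<^sub>0 'k) set)"
      by (rule relation_space_generator[OF lie_relations.antisymmetry[OF assms]])
    then show ?thesis by (simp only: lie_class_add_abs abs_lie_eq_0)
  qed
  then show ?thesis
    by (simp add: eq_neg_iff_add_eq_0)
qed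

text \<open>The counterpart in the quotient of the vanishing of \<open>leib2\<close>: antisymmetry
  turns the Jacobi relations into a rule that moves \<open>x\<close> to the leftmost place.\<close>

lemma lie_leibniz:
  fixes n C
  defines "J \<equiv> \<lambda>i j x y z. lie_class (plug C (Br i x (Br j y z))) - lie_class (plug C (Br i (Br j x y) z))
      + (lie_class (plug C (Br i (Br j x z) y)) :: 'k::field lie)"
  assumes "bracketed_permutation n (plug C (Br i x (Br j y z)))"
  shows "if i = j then J i i x y z = 0 else J i j x y z + J j i x y z = 0"
proof -
  let ?c = "\<lambda>t. lie_class (plug C t) :: 'k lie"
  have bp: "bracketed_permutation n (plug C u)" if "mset (letters u) = mset (letters x) + mset (letters y) + mset (letters z)" for u
    by (rule bracketed_permutation_plug_cong[OF assms(2)]) (simp add: that)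
  have J: "J p q x y z = ?c (Br p x (Br q y z)) + ?c (Br p z (Br q x y)) + ?c (Br p y (Br q z x))" for p q
  proof -
    have "?c (Br p z (Br q x y)) = - ?c (Br p (Br q x y) z)"
      by (rule lie_antisymmetry[OF bp]) simp
    moreover have "?c (Br p y (Br q z x)) = - ?c (Br p (Br q z x) y)"
      by (rule lie_antisymmetry[OF bp]) simp
    moreover have "?c (Br p (Br q z x) y) = - ?c (Br p (Br q x z) y)"
      using lie_antisymmetry[of n "compose C (InLeft p Hole y)" q z x] bp[of "Br p (Br q z x) y"]
      by (simp add: plug_compose)
    ultimately show ?thesis by (simp add: J_def)
  qed
  show ?thesis
  proof (cases "i = j")
    case True
    have "?c (Br i x (Br i y z)) + ?c (Br i z (Br i x y)) + ?c (Br i y (Br i z x)) = 0"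
    proof -
      have "basis_vector (plug C (Br i x (Br i y z))) + basis_vector (plug C (Br i z (Br i x y)))
          + basis_vector (plug C (Br i y (Br i z x))) \<in> (relation_space :: (_ \<Rightarrow>\<^sub>0 'k) set)"
        by (rule relation_space_generator[OF lie_relations.jacobi]) (use assms(2) True in simp)
      then show ?thesis by (simp only: lie_class_add_abs abs_lie_eq_0)
    qed
    with True show ?thesis by (simp add: J)
  next
    case False
    have "?c (Br i x (Br j y z)) + ?c (Br i z (Br j x y)) + ?c (Br i y (Br j z x))
      + ?c (Br j x (Br i y z)) + ?c (Br j z (Br i x y)) + ?c (Br j y (Br i z x)) = 0"
    proof -
      have "basis_vector (plug C (Br i x (Br j y z))) + basis_vector (plug C (Br i z (Br j x y)))
          + basis_vector (plug C (Br i y (Br j z x))) + basis_vector (plug C (Br j x (Br i y z)))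
          + basis_vector (plug C (Br j z (Br i x y))) + basis_vector (plug C (Br j y (Br i z x)))
          \<in> (relation_space :: (_ \<Rightarrow>\<^sub>0 'k) set)"
        by (rule relation_space_generator[OF lie_relations.mixed_jacobi[OF assms(2) False]])
      then show ?thesis by (simp only: lie_class_add_abs abs_lie_eq_0)
    qed
    with False show ?thesis by (simp add: J add_ac)
  qed
qed

definition same_content :: "bracketing \<Rightarrow> bracketing set" where
  "same_content u = {N. colored_comb N \<and> mset (letters N) = mset (letters u) \<and> bracket_types N = bracket_types u}"

text \<open>The relations are imposed on whole bracketed permutations, so a subtree is straightened
  in place, inside its context \<open>C\<close>.\<close>

definition comb_span :: "bracketing_context \<Rightarrow> bracketing \<Rightarrow> 'k::field lie set" where
  "comb_span C u = lie.span ((\<lambda>N. lie_class (plug C N)) ` same_content u)"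

text \<open>Two-stage rewriting: straighten \<open>u\<close> inside \<open>C\<close>, then treat
  each resulting bracketing as a bracketing inside \<open>D\<close>.\<close>

lemma comb_span_trans:
  assumes "lie_class (plug C u) \<in> (comb_span C u :: 'k::field lie set)"
    and "\<And>N. N \<in> same_content u \<Longrightarrow> lie_class (plug C N) \<in> (comb_span D v :: 'k lie set)"
  shows "lie_class (plug C u) \<in> (comb_span D v :: 'k::field lie set)"
proof -
  have "comb_span C u \<subseteq> (comb_span D v :: 'k lie set)"
    unfolding comb_span_def[of C u]
    by (rule lie.span_minimal) (use assms(2) in \<open>auto simp: comb_span_def lie.subspace_span\<close>)
  with assms(1) show ?thesis by blast
qed

lemma comb_span_cong:
  "mset (letters u) = mset (letters v) \<Longrightarrow> bracket_types u = bracket_types v \<Longrightarrow> comb_span C u = comb_span C v"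
  by (simp add: comb_span_def same_content_def)

lemma color_sum_cong: "bracket_types u = bracket_types v \<Longrightarrow> color_sum u = color_sum v"
  by (simp add: color_sum_def)

lemma size_cong: "mset (letters u) = mset (letters v) \<Longrightarrow> size u = size v"
  using length_letters[of u] length_letters[of v] by (metis Suc_inject size_mset)

text \<open>The induction measures only the right argument \<open>B\<close>; the left one may grow.
  If \<open>B\<close> is \<open>[D, E]\<^sub>j\<close> with \<open>i \<le> j\<close>, then
  \<open>lie_leibniz\<close> leaves brackets whose right arguments are smaller, and for
  \<open>i < j\<close> also \<open>[A, [D, E]\<^sub>i]\<^sub>j\<close>, whose right argument has
  smaller color sum.\<close>

lemma straighten_Br:
  fixes n :: nat
  shows "colored_comb A \<Longrightarrow> colored_comb B \<Longrightarrow> min_letter A < min_letter B \<Longrightarrow>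
    bracketed_permutation n (plug C (Br i A B)) \<Longrightarrow>
    lie_class (plug C (Br i A B)) \<in> (comb_span C (Br i A B) :: 'k::field lie set)"
proof (induction B arbitrary: A C i rule: wf_induct[where r = "measures [size, color_sum]"])
  case 1
  show ?case by simp
next
  case (2 B)
  have IH: "lie_class (plug C (Br i A X)) \<in> (comb_span C (Br i A X) :: 'k lie set)"
    if "colored_comb A" "colored_comb X" "min_letter A < min_letter X"
      "bracketed_permutation n (plug C (Br i A X))"
      "size X < size B \<or> size X = size B \<and> color_sum X < color_sum B" for X A C i
    using 2 that by auto
  show ?case
  proof (cases "below i B")
    case True
    with 2 have "Br i A B \<in> same_content (Br i A B)"
      by (simp add: same_content_def colored_comb_def)
    then show ?thesis
      unfolding comb_span_def by (intro lie.span_base) auto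
  next
    case False
    then obtain j D E where B: "B = Br j D E" and ij: "i \<le> j"
      by (cases B) auto
    let ?c = "\<lambda>t. lie_class (plug C t) :: 'k lie"
    let ?T = "comb_span C (Br i A B) :: 'k lie set"
    have D: "colored_comb D" and E: "colored_comb E" and DE: "min_letter D < min_letter E"
      using 2 B by (auto simp: colored_comb_def)
    have AD: "min_letter A < min_letter D" and AE: "min_letter A < min_letter E"
      using 2 B DE by auto
    have bp: "bracketed_permutation n (plug C u)" if "mset (letters u) = mset (letters (Br i A B))" for u
      by (rule bracketed_permutation_plug_cong[of n C "Br i A B"]) (use 2 that in auto)
    \<comment> \<open>The induction hypothesis is used twice: for the inner bracket with right
      argument \<open>X\<close>, then for \<open>Y\<close> bracketed onto each comb \<open>N\<close>
      so obtained. \<open>N\<close> still contains the least letter, as it has the letters of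
      \<open>A\<close> and \<open>X\<close>.\<close>
    have left: "?c (Br p (Br q A X) Y) \<in> ?T"
      if pq: "p = i \<and> q = j \<or> p = j \<and> q = i" and XY: "X = D \<and> Y = E \<or> X = E \<and> Y = D" for p q X Y
    proof -
      have props: "colored_comb X" "colored_comb Y" "min_letter A < min_letter X" "min_letter A < min_letter Y"
        "size X < size B" "size Y < size B"
        using XY D E AD AE B by auto
      have ms: "mset (letters X) + mset (letters Y) = mset (letters B)"
        "bracket_types X + bracket_types Y + Poly_Mapping.single j 1 = bracket_types B"
        using XY B by (auto simp: add_ac)
      let ?C = "compose C (InLeft p Hole Y)"
      have "lie_class (plug ?C (Br q A X)) \<in> (comb_span ?C (Br q A X) :: 'k lie set)"
        by (rule IH) (use props 2 ms in \<open>auto simp: plug_compose intro!: bp\<close>)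
      then have "lie_class (plug ?C (Br q A X)) \<in> ?T"
      proof (rule comb_span_trans)
        fix N assume N: "N \<in> same_content (Br q A X)"
        then have "min_letter N = min_letter A"
          using min_letter_mset_cong[of N "Br q A X"] props(3) by (auto simp: same_content_def)
        then have "?c (Br p N Y) \<in> comb_span C (Br p N Y)"
          by (intro IH) (use N props ms in \<open>auto simp: same_content_def intro!: bp\<close>)
        also have "comb_span C (Br p N Y) = ?T"
          using pq XY N unfolding B
          by (intro comb_span_cong) (auto simp: same_content_def ac_simps)
        finally show "lie_class (plug ?C N) \<in> ?T"
          by (simp add: plug_compose)
      qed
      then show ?thesis by (simp add: plug_compose)
    qed
    have rel: "if i = j then ?c (Br i A (Br i D E)) - ?c (Br i (Br i A D) E) + ?c (Br i (Br i A E) D) = 0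
      else ?c (Br i A (Br j D E)) - ?c (Br i (Br j A D) E) + ?c (Br i (Br j A E) D)
        + (?c (Br j A (Br i D E)) - ?c (Br j (Br i A D) E) + ?c (Br j (Br i A E) D)) = 0"
      by (rule lie_leibniz) (use 2 B in simp)
    show ?thesis
    proof (cases "i = j")
      case True
      with rel have "?c (Br i A B) = ?c (Br i (Br i A D) E) - ?c (Br i (Br i A E) D)"
        by (simp add: B algebra_simps)
      also have "\<dots> \<in> ?T"
        unfolding comb_span_def
        by (rule lie.span_diff; fold comb_span_def; rule left) (use True in auto)
      finally show ?thesis .
    next
      case False
      with ij have "i < j" by simp
      let ?C = "compose C (InRight j A Hole)"
      \<comment> \<open>First \<open>[D, E]\<^sub>i\<close> is straightened, its right argument
        \<open>E\<close> being smaller than \<open>B\<close>. The combs \<open>N\<close> obtained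
        have the size of \<open>B\<close>, but color sum smaller by \<open>j - i\<close>, which
        permits the second use of the hypothesis.\<close>
      have "lie_class (plug ?C (Br i D E)) \<in> (comb_span ?C (Br i D E) :: 'k lie set)"
        by (rule IH) (use D E DE B in \<open>auto simp: plug_compose intro!: bp\<close>)
      then have "lie_class (plug ?C (Br i D E)) \<in> ?T"
      proof (rule comb_span_trans)
        fix N assume N: "N \<in> same_content (Br i D E)"
        then have "min_letter N = min_letter D" "size N = size B" "color_sum N < color_sum B"
          using min_letter_mset_cong[of N "Br i D E"] size_cong[of N "Br i D E"]
            color_sum_cong[of N "Br i D E"] DE B \<open>i < j\<close> by (auto simp: same_content_def)
        then have "?c (Br j A N) \<in> comb_span C (Br j A N)"
          by (intro IH) (use N 2 AD B in \<open>auto simp: same_content_def intro!: bp\<close>)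
        also have "comb_span C (Br j A N) = ?T"
          by (rule comb_span_cong) (use N B in \<open>auto simp: same_content_def add_ac\<close>)
        finally show "lie_class (plug ?C N) \<in> ?T"
          by (simp add: plug_compose)
      qed
      then have right: "?c (Br j A (Br i D E)) \<in> ?T" by (simp add: plug_compose)
      have move: "x = (a - b) + (c - d) - y" if "x - a + b + (y - c + d) = 0" for x y a b c d :: "'k lie"
      proof -
        have "x = (x - a + b + (y - c + d)) + ((a - b) + (c - d) - y)" by (simp add: algebra_simps)
        then show ?thesis using that by simp
      qed
      have "?c (Br i A B) = (?c (Br i (Br j A D) E) - ?c (Br i (Br j A E) D))
          + (?c (Br j (Br i A D) E) - ?c (Br j (Br i A E) D)) - ?c (Br j A (Br i D E))"
        unfolding B by (rule move) (use rel False in simp)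
      also have "\<dots> \<in> ?T"
        using left[of i j D E] left[of i j E D] left[of j i D E] left[of j i E D] right
        unfolding comb_span_def by (auto intro!: lie.span_diff lie.span_add)
      finally show ?thesis .
    qed
  qed
qed

text \<open>Both arguments of the root are straightened in place, one after the other; antisymmetry
  then moves the least letter to the left, and \<open>straighten_Br\<close> applies.\<close>

lemma straighten:
  "bracketed_permutation n (plug C u) \<Longrightarrow> lie_class (plug C u) \<in> (comb_span C u :: 'k::field lie set)"
proof (induction u arbitrary: C)
  case (Leaf a)
  have "Leaf a \<in> same_content (Leaf a)" by (simp add: same_content_def colored_comb_def)
  then show ?case
    unfolding comb_span_def by (intro lie.span_base) auto
next
  case (Br i s t)
  let ?T = "comb_span C (Br i s t) :: 'k lie set"
  have bp: "bracketed_permutation n (plug C u)" if "mset (letters u) = mset (letters (Br i s t))" for u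
    by (rule bracketed_permutation_plug_cong[of n C "Br i s t"]) (use Br that in auto)
  have both: "lie_class (plug C (Br i M N)) \<in> ?T" if M: "M \<in> same_content s" and N: "N \<in> same_content t" for M N
  proof -
    have eq: "comb_span C (Br i M N) = ?T" "comb_span C (Br i N M) = ?T"
      by (rule comb_span_cong; use M N in \<open>simp add: same_content_def add_ac\<close>)+
    have b: "bracketed_permutation n (plug C (Br i M N))" "bracketed_permutation n (plug C (Br i N M))"
      by (rule bp; use M N in \<open>simp add: same_content_def add_ac\<close>)+
    then have "distinct (letters (Br i M N))"
      by - (rule distinct_letters_plug[of C], simp add: bracketed_permutation_def)
    then have "min_letter M \<noteq> min_letter N"
      using min_letter_in[of M] min_letter_in[of N] by auto
    then consider "min_letter M < min_letter N" | "min_letter N < min_letter M" by linarith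
    then show ?thesis
    proof cases
      case 1
      with M N b(1) have "lie_class (plug C (Br i M N)) \<in> (comb_span C (Br i M N) :: 'k lie set)"
        by (intro straighten_Br) (auto simp: same_content_def)
      then show ?thesis by (simp add: eq)
    next
      case 2
      with M N b(2) have "lie_class (plug C (Br i N M)) \<in> (comb_span C (Br i N M) :: 'k lie set)"
        by (intro straighten_Br) (auto simp: same_content_def)
      then have "- lie_class (plug C (Br i N M)) \<in> ?T"
        unfolding eq unfolding comb_span_def by (rule lie.span_neg)
      then show ?thesis by (simp add: lie_antisymmetry[OF b(1)])
    qed
  qed
  have "lie_class (plug (compose C (InLeft i Hole t)) s) \<in> ?T"
  proof (rule comb_span_trans[OF Br.IH(1)])
    show "bracketed_permutation n (plug (compose C (InLeft i Hole t)) s)"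
      using Br.prems by (simp add: plug_compose)
    fix M assume M: "M \<in> same_content s"
    have "lie_class (plug (compose C (InRight i M Hole)) t) \<in> ?T"
    proof (rule comb_span_trans[OF Br.IH(2)])
      show "bracketed_permutation n (plug (compose C (InRight i M Hole)) t)"
        using M by (auto simp: plug_compose same_content_def intro!: bp)
    qed (use both[OF M] in \<open>simp add: plug_compose\<close>)
    then show "lie_class (plug (compose C (InLeft i Hole t)) M) \<in> ?T"
      by (simp add: plug_compose)
  qed
  then show ?case by (simp add: plug_compose)
qed

section \<open>The colored combs as a basis\<close>

definition colored_combs :: "nat set \<Rightarrow> (nat \<Rightarrow>\<^sub>0 nat) \<Rightarrow> bracketing set" where
  "colored_combs S \<mu> = {t. colored_comb t \<and> distinct (letters t) \<and> set (letters t) = S \<and> bracket_types t = \<mu>}"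

lemma dim_Lie: "lie.dim (Lie n \<mu> :: 'k::field lie set) = card (colored_combs {1..n} \<mu>)"
proof -
  let ?B = "colored_combs {1..n} \<mu>"
  have "lie.span (lie_class ` ?B) = lie.span (Lie n \<mu> :: 'k lie set)"
  proof -
    have "lie_class ` ?B \<subseteq> (Lie n \<mu> :: 'k lie set)"
      unfolding Lie_def
      by (auto simp: colored_combs_def bracketed_permutation_def intro!: lie.span_base)
    moreover have "Lie n \<mu> \<subseteq> (lie.span (lie_class ` ?B) :: 'k lie set)"
      unfolding Lie_def
    proof (intro lie.span_minimal lie.subspace_span, safe)
      fix t assume t: "bracketed_permutation n t" "\<mu> = bracket_types t"
      then have "lie_class t \<in> (comb_span Hole t :: 'k lie set)"
        using straighten[of n Hole t] by simp
      moreover have "same_content t \<subseteq> colored_combs {1..n} (bracket_types t)"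
      proof
        fix N assume N: "N \<in> same_content t"
        with t(1) have "bracketed_permutation n N"
          by (simp add: same_content_def bracketed_permutation_iff)
        with N show "N \<in> colored_combs {1..n} (bracket_types t)"
          by (simp add: same_content_def colored_combs_def bracketed_permutation_def)
      qed
      ultimately show "lie_class t \<in> (lie.span (lie_class ` colored_combs {1..n} (bracket_types t)) :: 'k lie set)"
        by (auto simp: comb_span_def intro: subsetD[OF lie.span_mono[OF image_mono]])
    qed
    ultimately show ?thesis
      by (metis lie.span_mono lie.span_span subset_antisym)
  qed
  moreover have "lie.independent (lie_class ` ?B :: 'k lie set)"
    by (rule independent_colored_combs) (auto simp: colored_combs_def)
  ultimately have "lie.dim (Lie n \<mu> :: 'k lie set) = card (lie_class ` ?B :: 'k lie set)"
    by (rule lie.dim_eq_card)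
  also have "\<dots> = card ?B"
    by (rule card_image) (rule inj_on_subset[OF inj_on_lie_class], auto simp: colored_combs_def)
  finally show ?thesis .
qed

section \<open>The ring of formal power series\<close>

definition deg :: "(nat \<Rightarrow>\<^sub>0 nat) \<Rightarrow> nat"
  where "deg \<mu> = (\<Sum>i\<in>Poly_Mapping.keys \<mu>. Poly_Mapping.lookup \<mu> i)"

lemma WComp_iff: "\<mu> \<in> WComp n \<longleftrightarrow> deg \<mu> = n"
  by (simp add: WComp_def deg_def)

lemma deg_superset:
  assumes "finite K" "Poly_Mapping.keys \<mu> \<subseteq> K"
  shows "deg \<mu> = (\<Sum>i\<in>K. Poly_Mapping.lookup \<mu> i)"
  unfolding deg_def
  by (rule sum.mono_neutral_left) (use assms in \<open>auto simp: in_keys_iff\<close>)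

lemma deg_add: "deg (\<mu> + \<nu>) = deg \<mu> + deg \<nu>"
proof -
  let ?K = "Poly_Mapping.keys \<mu> \<union> Poly_Mapping.keys \<nu>"
  have "Poly_Mapping.keys (\<mu> + \<nu>) \<subseteq> ?K"
    by (rule Poly_Mapping.keys_add)
  then show ?thesis
    by (simp add: deg_superset[of ?K] lookup_add sum.distrib)
qed

lemma deg_simps [simp]: "deg 0 = 0" "deg (Poly_Mapping.single i k) = k"
  by (simp_all add: deg_def)

lemma deg_eq_0_iff [simp]: "deg \<mu> = 0 \<longleftrightarrow> \<mu> = 0"
  by (auto simp: deg_def in_keys_iff intro: poly_mapping_eqI)

lemma keys_plus: "Poly_Mapping.keys (\<alpha> + \<beta> :: nat \<Rightarrow>\<^sub>0 nat) = Poly_Mapping.keys \<alpha> \<union> Poly_Mapping.keys \<beta>"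
  by (auto simp: in_keys_iff lookup_add)

text \<open>Each such \<alpha> divides the monomial with exponent \<open>d\<close> at every index in
  \<open>K\<close>, and a monomial has only finitely many decompositions.\<close>

lemma finite_bounded_deg:
  assumes "finite K"
  shows "finite {\<alpha>. deg \<alpha> = d \<and> Poly_Mapping.keys \<alpha> \<subseteq> K}"
proof (rule finite_subset)
  let ?\<mu> = "\<Sum>k\<in>K. Poly_Mapping.single k d"
  show "finite (fst ` {(\<alpha>, \<beta>). \<alpha> + \<beta> = ?\<mu>})"
    by (intro finite_imageI finite_decompositions)
  show "{\<alpha>. deg \<alpha> = d \<and> Poly_Mapping.keys \<alpha> \<subseteq> K} \<subseteq> fst ` {(\<alpha>, \<beta>). \<alpha> + \<beta> = ?\<mu>}"
  proof
    fix \<alpha> assume \<alpha>: "\<alpha> \<in> {\<alpha>. deg \<alpha> = d \<and> Poly_Mapping.keys \<alpha> \<subseteq> K}"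
    have "Poly_Mapping.lookup \<alpha> i \<le> d" for i
      using \<alpha> member_le_sum[of i "Poly_Mapping.keys \<alpha>" "Poly_Mapping.lookup \<alpha>"]
      by (cases "i \<in> Poly_Mapping.keys \<alpha>") (auto simp: deg_def in_keys_iff)
    then have "\<alpha> + (?\<mu> - \<alpha>) = ?\<mu>"
      using \<alpha> assms
      by (intro poly_mapping_eqI)
        (auto simp: lookup_add lookup_minus lookup_sum lookup_single when_def sum.delta in_keys_iff subset_iff)
    then have "(\<alpha>, ?\<mu> - \<alpha>) \<in> {(\<alpha>, \<beta>). \<alpha> + \<beta> = ?\<mu>}" by simp
    then show "\<alpha> \<in> fst ` {(\<alpha>, \<beta>). \<alpha> + \<beta> = ?\<mu>}"
      by (rule image_eqI[rotated]) simp
  qed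
qed

text \<open>Provides terms of least degree for excluding zero divisors; the integral domain is what
  allows cancellation in \<open>fps_compose_left_right_inverse\<close>.\<close>

lemma xseries_neq_0E:
  assumes "f \<noteq> (0 :: xseries)"
  obtains \<alpha> where "xcoeff f \<alpha> \<noteq> 0" "\<And>\<alpha>'. xcoeff f \<alpha>' \<noteq> 0 \<Longrightarrow> deg \<alpha> \<le> deg \<alpha>'"
proof -
  from assms obtain \<alpha> where "xcoeff f \<alpha> \<noteq> 0"
    using xseries_eqI[of f 0] by (auto simp: xcoeff_simps)
  then obtain \<beta> where "xcoeff f \<beta> \<noteq> 0 \<and> (\<forall>\<alpha>'. xcoeff f \<alpha>' \<noteq> 0 \<longrightarrow> deg \<beta> \<le> deg \<alpha>')"
    using ex_has_least_nat[of "\<lambda>\<alpha>. xcoeff f \<alpha> \<noteq> 0" \<alpha> deg] by blast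
  then show ?thesis
    using that[of \<beta>] by blast
qed

text \<open>
  There are no least monomials among infinitely many variables; restricting the terms of least
  degree to finitely many variables makes a leading monomial available.
\<close>

instance xseries :: idom
proof
  fix f g :: xseries
  assume "f \<noteq> 0" "g \<noteq> 0"
  from \<open>f \<noteq> 0\<close> obtain \<alpha> where \<alpha>: "xcoeff f \<alpha> \<noteq> 0" "\<And>\<alpha>'. xcoeff f \<alpha>' \<noteq> 0 \<Longrightarrow> deg \<alpha> \<le> deg \<alpha>'"
    by (rule xseries_neq_0E) blast
  from \<open>g \<noteq> 0\<close> obtain \<beta> where \<beta>: "xcoeff g \<beta> \<noteq> 0" "\<And>\<beta>'. xcoeff g \<beta>' \<noteq> 0 \<Longrightarrow> deg \<beta> \<le> deg \<beta>'"
    by (rule xseries_neq_0E) blast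
  define K where "K = Poly_Mapping.keys \<alpha> \<union> Poly_Mapping.keys \<beta>"
  define A where "A = {\<alpha>' \<in> {\<alpha>'. deg \<alpha>' = deg \<alpha> \<and> Poly_Mapping.keys \<alpha>' \<subseteq> K}. xcoeff f \<alpha>' \<noteq> 0}"
  define B where "B = {\<beta>' \<in> {\<beta>'. deg \<beta>' = deg \<beta> \<and> Poly_Mapping.keys \<beta>' \<subseteq> K}. xcoeff g \<beta>' \<noteq> 0}"
  have fin: "finite A" "finite B"
    unfolding A_def B_def by (intro finite_Collect_conjI disjI1; simp add: K_def finite_bounded_deg)+
  have ne: "A \<noteq> {}" "B \<noteq> {}"
    using \<alpha> \<beta> by (auto simp: A_def B_def K_def)
  \<comment> \<open>The minimum refers to the linear order on exponent vectors, which is compatible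
    with addition.\<close>
  define a where "a = Min A"
  define b where "b = Min B"
  have a: "a \<in> A" and b: "b \<in> B"
    using fin ne by (simp_all add: a_def b_def)
  \<comment> \<open>Least degree in both factors forces the degrees of \<open>a'\<close> and
    \<open>b'\<close>, and the support of the sum confines them to \<open>K\<close>; hence both lie
    in the finite sets, where the minima can be compared.\<close>
  have unique: "a' = a \<and> b' = b" if "a' + b' = a + b" "xcoeff f a' \<noteq> 0" "xcoeff g b' \<noteq> 0" for a' b'
  proof -
    have "deg a' + deg b' = deg \<alpha> + deg \<beta>"
      using that(1) a b by (metis (mono_tags, lifting) A_def B_def mem_Collect_eq deg_add)
    with \<alpha>(2)[OF that(2)] \<beta>(2)[OF that(3)] have "deg a' = deg \<alpha>" "deg b' = deg \<beta>"
      by linarith+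
    moreover have "Poly_Mapping.keys a' \<union> Poly_Mapping.keys b' \<subseteq> K"
      using that(1) a b by (metis (mono_tags, lifting) A_def B_def Un_least mem_Collect_eq keys_plus)
    ultimately have "a' \<in> A" "b' \<in> B"
      using that by (auto simp: A_def B_def)
    then have "a \<le> a'" "b \<le> b'"
      using fin by (simp_all add: a_def b_def)
    with that(1) show ?thesis
      by (metis add_less_le_mono add_le_less_mono order_less_irrefl order_le_less)
  qed
  have "xcoeff (f * g) (a + b) = (\<Sum>(a', b')\<in>{(a, b)}. xcoeff f a' * xcoeff g b')"
    unfolding xcoeff_simps
    by (rule sum.mono_neutral_right) (use unique in \<open>auto simp: finite_decompositions\<close>)
  also have "\<dots> \<noteq> 0"
    using a b by (simp add: A_def B_def)
  finally show "f * g \<noteq> 0"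
    by (auto simp: xcoeff_simps(1))
qed

lemma xcoeff_sum: "xcoeff (sum f A) \<mu> = (\<Sum>x\<in>A. xcoeff (f x) \<mu>)"
  by (induction A rule: infinite_finite_induct) (auto simp: xcoeff_simps)

lemma xconst_simps:
  "xconst 0 = 0" "xconst 1 = 1"
  "xconst (p + q) = xconst p + xconst q"
  "xconst (p * q) = xconst p * xconst q"
proof -
  show "xconst (p * q) = xconst p * xconst q"
  proof (rule xseries_eqI)
    fix \<mu> :: "nat \<Rightarrow>\<^sub>0 nat"
    have "(\<Sum>(\<alpha>, \<beta>)\<in>{(\<alpha>, \<beta>). \<alpha> + \<beta> = \<mu>}. (if \<alpha> = 0 then p else 0) * (if \<beta> = 0 then q else 0))
        = (\<Sum>(\<alpha>, \<beta>)\<in>(if \<mu> = 0 then {(0 :: nat \<Rightarrow>\<^sub>0 nat, 0 :: nat \<Rightarrow>\<^sub>0 nat)} else {}). p * q)"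
      by (rule sum.mono_neutral_cong_right) (auto simp: finite_decompositions split: if_splits)
    then show "xcoeff (xconst (p * q)) \<mu> = xcoeff (xconst p * xconst q) \<mu>"
      by (auto simp: xcoeff_simps)
  qed
qed (auto intro!: xseries_eqI simp: xcoeff_simps)

lemma xconst_of_nat: "xconst (of_nat n) = of_nat n"
  by (induction n) (simp_all add: xconst_simps)

definition xvar :: "nat \<Rightarrow> xseries"
  where "xvar c = xsum {Poly_Mapping.single c 1} (\<lambda>_. 1)"

lemma xcoeff_xvar_mult:
  "xcoeff (xvar c * f) \<mu> =
    (if Poly_Mapping.lookup \<mu> c = 0 then 0 else xcoeff f (\<mu> - Poly_Mapping.single c 1))"
proof (cases "Poly_Mapping.lookup \<mu> c = 0")
  case True
  then have "\<alpha> + \<beta> = \<mu> \<Longrightarrow> \<alpha> \<noteq> Poly_Mapping.single c 1" for \<alpha> \<beta>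
    by (auto simp: lookup_add)
  with True show ?thesis
    by (auto simp: xvar_def xcoeff_simps intro!: sum.neutral)
next
  case False
  let ?s = "Poly_Mapping.single c (1::nat)"
  from False have \<mu>: "?s + (\<mu> - ?s) = \<mu>"
    by (intro poly_mapping_eqI) (auto simp: lookup_add lookup_minus lookup_single when_def)
  have "xcoeff (xvar c * f) \<mu> = (\<Sum>(\<alpha>, \<beta>)\<in>{(?s, \<mu> - ?s)}. (if \<alpha> \<in> {?s} then 1 else 0) * xcoeff f \<beta>)"
    unfolding xvar_def xcoeff_simps
    by (rule sum.mono_neutral_right) (use \<mu> in \<open>auto simp: finite_decompositions split: if_splits\<close>)
  with False show ?thesis by simp
qed

section \<open>Counting colored combs\<close>

lemma finite_bracketings:
  assumes "finite S" "finite K"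
  shows "finite {t. size t \<le> n \<and> set (letters t) \<subseteq> S \<and> Poly_Mapping.keys (bracket_types t) \<subseteq> K}"
proof -
  define T where "T n = {t. size t \<le> n \<and> set (letters t) \<subseteq> S \<and> Poly_Mapping.keys (bracket_types t) \<subseteq> K}" for n
  have "finite (T n)" for n
  proof (induction n)
    case 0
    have "T 0 \<subseteq> Leaf ` S"
    proof
      fix t assume "t \<in> T 0" then show "t \<in> Leaf ` S" by (cases t) (auto simp: T_def)
    qed
    then show ?case using assms(1) by (meson finite_imageI finite_subset)
  next
    case (Suc n)
    have "T (Suc n) \<subseteq> Leaf ` S \<union> (\<lambda>(j, s, t). Br j s t) ` (K \<times> T n \<times> T n)"
    proof
      fix t assume t: "t \<in> T (Suc n)"
      show "t \<in> Leaf ` S \<union> (\<lambda>(j, s, t). Br j s t) ` (K \<times> T n \<times> T n)"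
      proof (cases t)
        case (Leaf a)
        with t show ?thesis by (simp add: T_def)
      next
        case (Br j s u)
        with t have "(j, s, u) \<in> K \<times> T n \<times> T n"
          by (simp add: T_def keys_plus)
        then show ?thesis unfolding Br by (intro UnI2 image_eqI[of _ _ "(j, s, u)"]) simp_all
      qed
    qed
    then show ?case
      by (rule finite_subset) (simp add: Suc assms)
  qed
  then show ?thesis by (simp add: T_def)
qed

lemma finite_colored_combs: "finite (colored_combs S \<mu>)"
proof (cases "finite S")
  case True
  have "size t \<le> card S" if "t \<in> colored_combs S \<mu>" for t
  proof -
    from that have "card S = length (letters t)"
      using distinct_card[of "letters t"] by (auto simp: colored_combs_def)
    then show ?thesis by (simp add: length_letters)
  qed
  then have "colored_combs S \<mu> \<subseteq> {t. size t \<le> card S \<and> set (letters t) \<subseteq> S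
      \<and> Poly_Mapping.keys (bracket_types t) \<subseteq> Poly_Mapping.keys \<mu>}"
    by (auto simp: colored_combs_def)
  then show ?thesis
    by (rule finite_subset) (rule finite_bracketings[OF True finite_keys])
next
  case False
  have "colored_combs S \<mu> = {}"
  proof (rule ccontr)
    assume "colored_combs S \<mu> \<noteq> {}"
    then obtain t where "set (letters t) = S" by (auto simp: colored_combs_def)
    with False show False by (metis List.finite_set)
  qed
  then show ?thesis by simp
qed

section \<open>Generating functions of colored combs by root type\<close>

definition comb_gf :: "nat set \<Rightarrow> xseries"
  where "comb_gf S = xsum UNIV (\<lambda>\<mu>. of_nat (card (colored_combs S \<mu>)))"

definition comb_gf_below :: "nat \<Rightarrow> nat set \<Rightarrow> xseries"
  where "comb_gf_below c S = xsum UNIV (\<lambda>\<mu>. of_nat (card {t \<in> colored_combs S \<mu>. below c t}))"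

definition comb_gf_root :: "nat \<Rightarrow> nat set \<Rightarrow> xseries"
  where "comb_gf_root c S = xsum UNIV (\<lambda>\<mu>. of_nat (card {t \<in> colored_combs S \<mu>. \<exists>s u. t = Br c s u}))"

lemma comb_gf_below_Suc: "comb_gf_below (Suc c) S = comb_gf_below c S + comb_gf_root c S"
proof (rule xseries_eqI)
  fix \<mu>
  have "{t \<in> colored_combs S \<mu>. below (Suc c) t} =
      {t \<in> colored_combs S \<mu>. below c t} \<union> {t \<in> colored_combs S \<mu>. \<exists>s u. t = Br c s u}"
    (is "_ = ?A \<union> ?B")
  proof (intro set_eqI)
    fix t show "t \<in> {t \<in> colored_combs S \<mu>. below (Suc c) t} \<longleftrightarrow> t \<in> ?A \<union> ?B"
      by (cases t) auto
  qed
  moreover have "?A \<inter> ?B = {}" by auto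
  ultimately have "card {t \<in> colored_combs S \<mu>. below (Suc c) t} = card ?A + card ?B"
    using finite_colored_combs by (simp add: card_Un_disjoint)
  then show "xcoeff (comb_gf_below (Suc c) S) \<mu> = xcoeff (comb_gf_below c S + comb_gf_root c S) \<mu>"
    by (simp add: comb_gf_below_def comb_gf_root_def xcoeff_simps)
qed

lemma comb_gf_below_0: "comb_gf_below 0 S = (if card S = 1 then 1 else 0)"
proof (rule xseries_eqI)
  fix \<mu>
  have "{t \<in> colored_combs S \<mu>. below 0 t} = {Leaf a | a. S = {a} \<and> \<mu> = 0}" (is "?L = ?R")
  proof (intro set_eqI)
    fix t show "t \<in> ?L \<longleftrightarrow> t \<in> ?R"
    proof (cases t)
      case (Leaf a)
      show ?thesis unfolding Leaf by (auto simp: colored_combs_def colored_comb_def)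
    next
      case (Br j s u)
      show ?thesis unfolding Br by simp
    qed
  qed
  also have "card \<dots> = (if card S = 1 \<and> \<mu> = 0 then 1 else 0)"
  proof (cases "card S = 1 \<and> \<mu> = 0")
    case True
    then obtain a where "S = {a}" by (auto simp: card_1_singleton_iff)
    then have "{Leaf a | a. S = {a} \<and> \<mu> = 0} = {Leaf a}" using True by auto
    with True show ?thesis by simp
  next
    case False
    then have "{Leaf a | a. S = {a} \<and> \<mu> = 0} = {}" by auto
    with False show ?thesis by (simp only: card.empty if_False)
  qed
  finally show "xcoeff (comb_gf_below 0 S) \<mu> = xcoeff (if card S = 1 then 1 else 0) \<mu>"
    by (simp add: comb_gf_below_def xcoeff_simps)
qed

text \<open>The root type occurs among the types counted by \<mu>. This is the coefficientwise limit
  as \<open>c\<close> tends to infinity.\<close>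

lemma xcoeff_comb_gf_below:
  assumes "Poly_Mapping.keys \<mu> \<subseteq> {..<c}"
  shows "xcoeff (comb_gf_below c S) \<mu> = xcoeff (comb_gf S) \<mu>"
proof -
  have "{t \<in> colored_combs S \<mu>. below c t} = colored_combs S \<mu>"
  proof (intro set_eqI)
    fix t show "t \<in> {t \<in> colored_combs S \<mu>. below c t} \<longleftrightarrow> t \<in> colored_combs S \<mu>"
      using assms by (cases t) (auto simp: colored_combs_def keys_plus)
  qed
  then show ?thesis by (simp add: comb_gf_below_def comb_gf_def xcoeff_simps)
qed

lemma comb_gf_below_empty: "comb_gf_below c {} = 0"
  by (rule xseries_eqI) (simp add: comb_gf_below_def xcoeff_simps colored_combs_def)

lemma min_letter_le: "a \<in> set (letters t) \<Longrightarrow> min_letter t \<le> a"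
  unfolding min_letter_def by (rule Min_le) auto

lemma min_letter_less_iff:
  assumes S: "set (letters s) \<union> set (letters u) = S" and disj: "set (letters s) \<inter> set (letters u) = {}"
  shows "min_letter s < min_letter u \<longleftrightarrow> Min S \<notin> set (letters u)"
proof -
  have fin: "finite S" using S by (metis List.finite_set finite_Un)
  have in_S: "min_letter s \<in> S" "min_letter u \<in> S"
    using S min_letter_in[of s] min_letter_in[of u] by blast+
  then have le: "Min S \<le> min_letter s" "Min S \<le> min_letter u"
    by (simp_all add: fin)
  have "Min S \<in> S"
    using fin in_S by (intro Min_in) auto
  then consider "Min S \<in> set (letters s)" "Min S \<notin> set (letters u)" | "Min S \<in> set (letters u)"
    using S by blast
  then show ?thesis
  proof cases
    case 1
    then have "min_letter s \<le> min_letter u"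
      using min_letter_le[of "Min S" s] le(2) by linarith
    moreover have "min_letter s \<noteq> min_letter u"
      using disj min_letter_in[of s] min_letter_in[of u] by force
    ultimately show ?thesis using 1 by simp
  next
    case 2
    then have "min_letter u \<le> min_letter s"
      using min_letter_le[of "Min S" u] le(1) by linarith
    with 2 show ?thesis by simp
  qed
qed

text \<open>Removing a root of type \<open>c\<close> leaves an arbitrary colored comb on the left,
  which holds the least letter, and on the right a colored comb on a letter set \<open>R\<close>
  that is a leaf or has root type below \<open>c\<close>.\<close>

lemma comb_gf_root:
  assumes "finite S" "S \<noteq> {}"
  shows "comb_gf_root c S = xvar c * (\<Sum>R\<in>Pow (S - {Min S}). comb_gf (S - R) * comb_gf_below c R)"
proof (rule xseries_eqI)
  fix \<mu> :: "nat \<Rightarrow>\<^sub>0 nat"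
  define P where "P = Pow (S - {Min S})"
  define D where "D = {(\<alpha>, \<beta>). Poly_Mapping.single c 1 + \<alpha> + \<beta> = \<mu>}"
  define I where "I = P \<times> D"
  define T where "T = (\<lambda>(R, \<alpha>, \<beta>). colored_combs (S - R) \<alpha> \<times> {t \<in> colored_combs R \<beta>. below c t})"
  let ?f = "\<lambda>((R, \<alpha>, \<beta>), (s, u)). Br c s u"
  have D: "D = (if Poly_Mapping.lookup \<mu> c = 0 then {} else {(\<alpha>, \<beta>). \<alpha> + \<beta> = \<mu> - Poly_Mapping.single c 1})"
  proof -
    have "Poly_Mapping.single c 1 + \<alpha> + \<beta> = \<mu> \<longleftrightarrow> \<alpha> + \<beta> = \<mu> - Poly_Mapping.single c 1"
      if "Poly_Mapping.lookup \<mu> c \<noteq> 0" for \<alpha> \<beta>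
    proof -
      from that have "\<mu> = Poly_Mapping.single c 1 + (\<mu> - Poly_Mapping.single c 1)"
        by (intro poly_mapping_eqI) (auto simp: lookup_add lookup_minus lookup_single when_def)
      then show ?thesis by (metis add.assoc add_left_cancel)
    qed
    then show ?thesis
      by (auto simp: D_def lookup_add)
  qed
  have fin: "finite I"
    using assms(1) finite_decompositions by (auto simp: I_def P_def D)
  have "{t \<in> colored_combs S \<mu>. \<exists>s u. t = Br c s u} = ?f ` (SIGMA i:I. T i)" (is "?L = ?R")
  proof (intro set_eqI iffI)
    fix t assume "t \<in> ?L"
    then obtain s u where t: "t = Br c s u" and cc: "Br c s u \<in> colored_combs S \<mu>" by auto
    let ?U = "set (letters u)"
    have "Min S \<notin> ?U"
      using cc min_letter_less_iff[of s u S] by (auto simp: colored_combs_def colored_comb_def)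
    then have "((?U, bracket_types s, bracket_types u), (s, u)) \<in> (SIGMA i:I. T i)"
      using cc by (auto simp: I_def P_def D_def T_def colored_combs_def colored_comb_def)
    then show "t \<in> ?R"
      unfolding t by (rule image_eqI[rotated]) simp
  next
    fix t assume "t \<in> ?R"
    then obtain R \<alpha> \<beta> s u where t: "t = Br c s u" and "R \<in> P" "(\<alpha>, \<beta>) \<in> D"
      and su: "s \<in> colored_combs (S - R) \<alpha>" "u \<in> colored_combs R \<beta>" "below c u"
      by (auto simp: I_def T_def)
    moreover from this have "min_letter s < min_letter u"
      by (subst min_letter_less_iff[of s u S]) (auto simp: P_def colored_combs_def)
    ultimately show "t \<in> ?L"
      by (auto simp: P_def D_def colored_combs_def colored_comb_def)
  qed
  moreover have "inj_on ?f (SIGMA i:I. T i)"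
    by (rule inj_onI) (auto simp: T_def colored_combs_def)
  ultimately have "card {t \<in> colored_combs S \<mu>. \<exists>s u. t = Br c s u} = card (SIGMA i:I. T i)"
    by (simp add: card_image)
  also have "\<dots> = (\<Sum>i\<in>I. card (T i))"
    using fin by (intro card_SigmaI) (auto simp: T_def finite_colored_combs)
  also have "\<dots> = (\<Sum>R\<in>P. \<Sum>(\<alpha>, \<beta>)\<in>D. card (colored_combs (S - R) \<alpha>) * card {t \<in> colored_combs R \<beta>. below c t})"
  proof -
    have "(\<Sum>i\<in>I. card (T i)) = (\<Sum>R\<in>P. \<Sum>d\<in>D. card (T (R, d)))"
      unfolding I_def sum.cartesian_product by (rule sum.cong) auto
    also have "\<dots> = (\<Sum>R\<in>P. \<Sum>(\<alpha>, \<beta>)\<in>D. card (colored_combs (S - R) \<alpha>) * card {t \<in> colored_combs R \<beta>. below c t})"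
      by (intro sum.cong refl) (simp add: T_def card_cartesian_product case_prod_beta)
    finally show ?thesis .
  qed
  finally have "xcoeff (comb_gf_root c S) \<mu> = (\<Sum>R\<in>P. \<Sum>(\<alpha>, \<beta>)\<in>D. xcoeff (comb_gf (S - R)) \<alpha> * xcoeff (comb_gf_below c R) \<beta>)"
    by (simp add: comb_gf_root_def comb_gf_def comb_gf_below_def xcoeff_simps case_prod_beta)
  then show "xcoeff (comb_gf_root c S) \<mu> =
      xcoeff (xvar c * (\<Sum>R\<in>Pow (S - {Min S}). comb_gf (S - R) * comb_gf_below c R)) \<mu>"
    unfolding xcoeff_xvar_mult D P_def by (cases "Poly_Mapping.lookup \<mu> c = 0") (simp_all add: xcoeff_sum xcoeff_simps(6))
qed

lemma sum_Pow_card: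
  fixes g :: "nat \<Rightarrow> 'a::comm_ring_1"
  assumes "finite A"
  shows "(\<Sum>R\<in>Pow A. g (card R)) = (\<Sum>k=0..card A. of_nat (card A choose k) * g k)"
proof -
  have "(\<Sum>R\<in>Pow A. g (card R)) = (\<Sum>k=0..card A. \<Sum>R\<in>{R \<in> Pow A. card R = k}. g (card R))"
    using assms by (intro sum.group[symmetric]) (auto intro: card_mono)
  also have "\<dots> = (\<Sum>k=0..card A. of_nat (card A choose k) * g k)"
    using assms by (intro sum.cong) (auto simp: n_subsets)
  finally show ?thesis .
qed

text \<open>The hypothesis is restricted to nonempty \<open>R\<close> so that, in an induction on
  the number of letters, both parts are smaller than \<open>S\<close>. The summand for empty
  \<open>R\<close> is zero, since every bracketing has a letter.\<close>

lemma comb_gf_root_card: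
  assumes "finite S" "card S = Suc n"
    and "\<And>R. R \<subseteq> S - {Min S} \<Longrightarrow> R \<noteq> {} \<Longrightarrow>
      comb_gf (S - R) = comb_gf {1..Suc n - card R} \<and> comb_gf_below c R = comb_gf_below c {1..card R}"
  shows "comb_gf_root c S =
    xvar c * (\<Sum>k=0..n. of_nat (n choose k) * (comb_gf {1..Suc n - k} * comb_gf_below c {1..k}))"
proof -
  let ?g = "\<lambda>k. comb_gf {1..Suc n - k} * comb_gf_below c {1..k}"
  have "S \<noteq> {}" using assms(2) by auto
  then have card: "card (S - {Min S}) = n" using assms(1,2) by simp
  have "comb_gf_root c S = xvar c * (\<Sum>R\<in>Pow (S - {Min S}). comb_gf (S - R) * comb_gf_below c R)"
    by (rule comb_gf_root) fact+
  also have "(\<Sum>R\<in>Pow (S - {Min S}). comb_gf (S - R) * comb_gf_below c R) = (\<Sum>R\<in>Pow (S - {Min S}). ?g (card R))"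
  proof (rule sum.cong)
    fix R assume R: "R \<in> Pow (S - {Min S})"
    show "comb_gf (S - R) * comb_gf_below c R = ?g (card R)"
    proof (cases "R = {}")
      case True
      then show ?thesis by (simp add: comb_gf_below_empty)
    next
      case False
      with R assms(3)[of R] show ?thesis by simp
    qed
  qed simp
  also have "\<dots> = (\<Sum>k=0..n. of_nat (n choose k) * ?g k)"
    using sum_Pow_card[of "S - {Min S}" ?g] assms(1) by (simp add: card)
  finally show ?thesis .
qed

lemma comb_gf_cong:
  assumes "\<And>c. comb_gf_below c S = comb_gf_below c S'"
  shows "comb_gf S = comb_gf S'"
proof (rule xseries_eqI)
  fix \<mu> :: "nat \<Rightarrow>\<^sub>0 nat"
  obtain c where "Poly_Mapping.keys \<mu> \<subseteq> {..<c}"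
    using finite_keys[of \<mu>] unfolding finite_nat_set_iff_bounded by blast
  then show "xcoeff (comb_gf S) \<mu> = xcoeff (comb_gf S') \<mu>"
    using assms[of c] xcoeff_comb_gf_below by metis
qed

text \<open>Instead of relabelling letters, the recursion at the root is used: by strong induction
  its parts depend only on cardinalities, and an inner induction on \<open>c\<close> adds up the
  root types.\<close>

lemma comb_gf_below_card_cong:
  "finite S \<Longrightarrow> finite S' \<Longrightarrow> card S = card S' \<Longrightarrow> comb_gf_below c S = comb_gf_below c S'"
proof (induction "card S" arbitrary: S S' c rule: less_induct)
  case less
  have hyps: "comb_gf_below c X = comb_gf_below c Y"
    if "finite X" "finite Y" "card X = card Y" "card X < card S" for X Y c
    by (rule less.hyps) fact+
  have root: "comb_gf_root c T =
      xvar c * (\<Sum>k=0..n. of_nat (n choose k) * (comb_gf {1..Suc n - k} * comb_gf_below c {1..k}))"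
    if T: "finite T" "card T = Suc n" "card T = card S" for T n c
  proof (rule comb_gf_root_card)
    fix R assume R: "R \<subseteq> T - {Min T}" "R \<noteq> {}"
    have "T \<noteq> {}" using T(2) by auto
    from R(1) have "R \<subseteq> T" by blast
    then have fin: "finite R" using T(1) finite_subset by blast
    then have "card R > 0" using R(2) by (simp add: card_gt_0_iff)
    have "card R \<le> card (T - {Min T})" using R(1) T(1) by (intro card_mono) simp_all
    also have "\<dots> < card T" using T(1) \<open>T \<noteq> {}\<close> by (intro card_Diff1_less Min_in)
    finally have lt: "card R < card S" using T(3) by simp
    have diff: "card (T - R) = Suc n - card R"
      using card_Diff_subset[OF fin \<open>R \<subseteq> T\<close>] T(2) by simp
    have lt': "card (T - R) < card S"
      using diff \<open>card R > 0\<close> T(2,3) by linarith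
    have "comb_gf_below d (T - R) = comb_gf_below d {1..Suc n - card R}" for d
      by (rule hyps[OF _ _ _ lt']) (simp_all only: T(1) diff finite_Diff finite_atLeastAtMost card_atLeastAtMost diff_Suc_1)
    then have "comb_gf (T - R) = comb_gf {1..Suc n - card R}"
      by (rule comb_gf_cong)
    moreover have "comb_gf_below c R = comb_gf_below c {1..card R}"
      by (rule hyps[OF _ _ _ lt]) (simp_all add: fin)
    ultimately show "comb_gf (T - R) = comb_gf {1..Suc n - card R} \<and> comb_gf_below c R = comb_gf_below c {1..card R}"
      by blast
  qed (fact T)+
  show ?case
  proof (cases "card S")
    case 0
    with less.prems have "S = {}" "S' = {}" by simp_all
    then show ?thesis by simp
  next
    case (Suc n)
    note n = this
    have root_eq: "comb_gf_root c S = comb_gf_root c S'" for c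
      unfolding root[OF less.prems(1) n refl] root[OF less.prems(2) n[unfolded less.prems(3)] less.prems(3)[symmetric]] ..
    show ?thesis
    proof (induction c)
      case 0
      show ?case unfolding comb_gf_below_0 less.prems(3) ..
    next
      case (Suc c)
      then show ?case unfolding comb_gf_below_Suc root_eq by (rule arg_cong)
    qed
  qed
qed

lemma comb_gf_root_Suc:
  "comb_gf_root c {1..Suc n} =
    xvar c * (\<Sum>k=0..n. of_nat (n choose k) * (comb_gf {1..Suc n - k} * comb_gf_below c {1..k}))"
proof (rule comb_gf_root_card)
  fix R assume R: "R \<subseteq> {1..Suc n} - {Min {1..Suc n}}"
  then have "finite R" by (rule finite_subset) simp
  moreover from this R have "card ({1..Suc n} - R) = Suc n - card R"
    by (subst card_Diff_subset) auto
  ultimately show "comb_gf ({1..Suc n} - R) = comb_gf {1..Suc n - card R} \<and>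
      comb_gf_below c R = comb_gf_below c {1..card R}"
    by (intro conjI comb_gf_cong comb_gf_below_card_cong) auto
qed auto

unbundle fps_syntax

section \<open>The compositional inverse\<close>

lemma fps_deriv_egf: "fps_deriv (egf f) $ n = xconst (1 / fact n) * f (Suc n)"
proof -
  have "of_nat (Suc n) * xconst (1 / fact (Suc n)) = xconst (1 / fact n)"
    by (simp add: divide_simps flip: xconst_of_nat xconst_simps(4) of_nat_Suc)
  then show ?thesis
    by (simp add: egf_def flip: mult.assoc del: of_nat_Suc fact_Suc)
qed

lemma egf_diff: "egf f - egf g = egf (\<lambda>n. f n - g n)"
  by (rule fps_ext) (simp add: egf_def right_diff_distrib)

lemma egf_cong: "(\<And>n. n > 0 \<Longrightarrow> f n = g n) \<Longrightarrow> egf f = egf g"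
  by (rule fps_ext) (simp add: egf_def)

lemma egf_nth: "f 0 = 0 \<Longrightarrow> egf f $ n = xconst (1 / fact n) * f n"
  by (simp add: egf_def)

definition comb_fps :: "xseries fps"
  where "comb_fps = egf (\<lambda>n. comb_gf {1..n})"

definition comb_fps_below :: "nat \<Rightarrow> xseries fps"
  where "comb_fps_below c = egf (\<lambda>n. comb_gf_below c {1..n})"

text \<open>The binomial convolution of \<open>comb_gf_root_Suc\<close> is a product of exponential
  generating functions. Since the least letter is always in the left part, only the other letters
  are distributed, which gives the derivatives.\<close>

lemma comb_fps_below_Suc:
  "fps_deriv (comb_fps_below (Suc c) - comb_fps_below c) =
    fps_const (xvar c) * comb_fps_below c * fps_deriv comb_fps"
proof (rule fps_ext)
  fix n
  let ?a = "\<lambda>n. comb_gf {1..n}" and ?b = "\<lambda>k. comb_gf_below c {1..k}"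
  have binom: "xconst (1 / fact n) * of_nat (n choose k) = xconst (1 / fact k) * xconst (1 / fact (n - k))"
    if "k \<le> n" for k
    using that by (simp add: binomial_fact flip: xconst_of_nat xconst_simps(4))
  have "comb_fps_below (Suc c) - comb_fps_below c = egf (\<lambda>n. comb_gf_root c {1..n})"
    by (simp add: comb_fps_below_def egf_diff comb_gf_below_Suc)
  then have "fps_deriv (comb_fps_below (Suc c) - comb_fps_below c) $ n =
      xconst (1 / fact n) * (xvar c * (\<Sum>k=0..n. of_nat (n choose k) * (?a (Suc n - k) * ?b k)))"
    by (simp only: fps_deriv_egf comb_gf_root_Suc)
  also have "\<dots> = (\<Sum>k=0..n. xvar c * ((xconst (1 / fact n) * of_nat (n choose k)) * (?a (Suc n - k) * ?b k)))"
    by (simp only: sum_distrib_left mult_ac)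
  also have "\<dots> = (\<Sum>k=0..n. (xvar c * (xconst (1 / fact k) * ?b k)) * (xconst (1 / fact (n - k)) * ?a (Suc (n - k))))"
    by (intro sum.cong refl, subst binom) (simp_all add: Suc_diff_le mult_ac)
  also have "\<dots> = (fps_const (xvar c) * comb_fps_below c * fps_deriv comb_fps) $ n"
    unfolding fps_mult_nth[of "fps_const (xvar c) * comb_fps_below c"]
    by (simp only: comb_fps_def comb_fps_below_def fps_deriv_egf fps_mult_left_const_nth)
      (simp add: egf_nth comb_gf_below_empty)
  finally show "fps_deriv (comb_fps_below (Suc c) - comb_fps_below c) $ n =
      (fps_const (xvar c) * comb_fps_below c * fps_deriv comb_fps) $ n" .
qed

section \<open>Complete homogeneous functions in the variables from index \<open>c\<close>
  on\<close>

definition hom_from :: "nat \<Rightarrow> nat \<Rightarrow> xseries"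
  where "hom_from c m = xsum {\<mu> \<in> WComp m. Poly_Mapping.keys \<mu> \<subseteq> {c..}} (\<lambda>_. 1)"

lemma hom_from_0: "hom_from c 0 = 1"
  by (rule xseries_eqI) (auto simp: hom_from_def xcoeff_simps WComp_iff)

text \<open>The monomials are split according to whether the variable with index \<open>c\<close>
  divides them.\<close>

lemma hom_from_Suc: "hom_from c (Suc m) = hom_from (Suc c) (Suc m) + xvar c * hom_from c m"
proof (rule xseries_eqI)
  fix \<mu> :: "nat \<Rightarrow>\<^sub>0 nat"
  show "xcoeff (hom_from c (Suc m)) \<mu> = xcoeff (hom_from (Suc c) (Suc m) + xvar c * hom_from c m) \<mu>"
  proof (cases "Poly_Mapping.lookup \<mu> c = 0")
    case True
    then have "Poly_Mapping.keys \<mu> \<subseteq> {c..} \<longleftrightarrow> Poly_Mapping.keys \<mu> \<subseteq> {Suc c..}"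
    proof -
      have "{Suc c..} = {c..} - {c}" by auto
      moreover have "c \<notin> Poly_Mapping.keys \<mu>" using True by (simp add: in_keys_iff)
      ultimately show ?thesis by blast
    qed
    with True show ?thesis
      by (simp add: xcoeff_simps(3) xcoeff_xvar_mult) (simp add: hom_from_def xcoeff_simps)
  next
    case False
    define \<nu> where "\<nu> = \<mu> - Poly_Mapping.single c 1"
    have \<mu>: "\<mu> = Poly_Mapping.single c 1 + \<nu>"
      unfolding \<nu>_def using False
      by (intro poly_mapping_eqI) (auto simp: lookup_add lookup_minus lookup_single when_def)
    have "xcoeff (hom_from (Suc c) (Suc m)) \<mu> = 0"
      by (auto simp: hom_from_def xcoeff_simps \<mu> keys_plus)
    moreover have "xcoeff (hom_from c (Suc m)) \<mu> = xcoeff (hom_from c m) \<nu>"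
      by (simp add: hom_from_def xcoeff_simps \<mu> keys_plus WComp_iff deg_add)
    ultimately show ?thesis
      using False by (simp add: xcoeff_simps(3) xcoeff_xvar_mult \<nu>_def)
  qed
qed

definition hom_fps :: "nat \<Rightarrow> xseries fps"
  where "hom_fps c = egf (\<lambda>n. (- 1) ^ (n - 1) * hom_from c (n - 1))"

lemma hom_fps_Suc: "fps_deriv (hom_fps (Suc c) - hom_fps c) = fps_const (xvar c) * hom_fps c"
proof (rule fps_ext)
  fix n
  show "fps_deriv (hom_fps (Suc c) - hom_fps c) $ n = (fps_const (xvar c) * hom_fps c) $ n"
  proof (cases n)
    case 0
    then show ?thesis
      unfolding hom_fps_def egf_diff fps_deriv_egf fps_mult_left_const_nth by (simp add: hom_from_0 egf_def)
  next
    case (Suc m)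
    have "hom_from (Suc c) (Suc m) - hom_from c (Suc m) = - xvar c * hom_from c m"
      by (simp add: hom_from_Suc[of c])
    then have "(-1) ^ Suc m * hom_from (Suc c) (Suc m) - (-1) ^ Suc m * hom_from c (Suc m)
        = (-1) ^ m * (xvar c * hom_from c m)"
      unfolding right_diff_distrib[symmetric] by simp
    then show ?thesis
      unfolding Suc hom_fps_def egf_diff fps_deriv_egf fps_mult_left_const_nth
      by (simp add: egf_def mult_ac)
  qed
qed

text \<open>For positive \<open>m\<close>, each monomial of \<open>hom_from c m\<close> involves a
  variable of index at least \<open>c\<close>. Hence \<open>hom_fps c\<close> tends coefficientwise
  to \<open>fps_X\<close> as \<open>c\<close> grows.\<close>

lemma xcoeff_hom_fps:
  assumes "Poly_Mapping.keys \<mu> \<subseteq> {..<c}"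
  shows "xcoeff (hom_fps c $ n) \<mu> = xcoeff (fps_X $ n) \<mu>"
proof -
  have *: "xcoeff (xconst r * f) \<mu> = r * xcoeff f \<mu>" for r f
  proof -
    have "xcoeff (xconst r * f) \<mu> = (\<Sum>(\<alpha>, \<beta>)\<in>{(0 :: nat \<Rightarrow>\<^sub>0 nat, \<mu>)}. (if \<alpha> = 0 then r else 0) * xcoeff f \<beta>)"
      unfolding xcoeff_simps
      by (rule sum.mono_neutral_right) (auto simp: finite_decompositions split: if_splits)
    then show ?thesis by simp
  qed
  consider "n = 0" | "n = 1" | m where "n = Suc (Suc m)"
    by (metis One_nat_def not0_implies_Suc)
  then show ?thesis
  proof cases
    case 3
    have "\<mu> \<notin> {\<mu> \<in> WComp (Suc m). Poly_Mapping.keys \<mu> \<subseteq> {c..}}"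
    proof
      assume \<mu>: "\<mu> \<in> {\<mu> \<in> WComp (Suc m). Poly_Mapping.keys \<mu> \<subseteq> {c..}}"
      then have "Poly_Mapping.keys \<mu> \<subseteq> {..<c} \<inter> {c..}" using assms by blast
      moreover have "{..<c} \<inter> {c..} = {}" by auto
      ultimately have "Poly_Mapping.keys \<mu> = {}" by blast
      with \<mu> show False by (simp add: WComp_def)
    qed
    then have "xcoeff (hom_from c (Suc m)) \<mu> = 0"
      by (simp add: hom_from_def xcoeff_simps)
    then have "xcoeff ((- 1) ^ Suc m * hom_from c (Suc m)) \<mu> = 0"
      by (cases "even (Suc m)") (simp_all add: xcoeff_simps(5))
    then show ?thesis
      using 3 by (simp add: hom_fps_def egf_def * xcoeff_simps(1) del: power_Suc)
  qed (simp_all add: hom_fps_def egf_def hom_from_0 xconst_simps)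
qed

text \<open>The difference \<open>D c\<close> of the two sides satisfies a homogeneous linear
  recursion in \<open>c\<close> and tends coefficientwise to zero, which forces it to vanish for
  every \<open>c\<close>.\<close>

lemma hom_fps_compose: "hom_fps c oo comb_fps = comb_fps_below c"
proof -
  define D where "D c = (hom_fps c oo comb_fps) - comb_fps_below c" for c
  have F0: "comb_fps $ 0 = 0" by (simp add: comb_fps_def egf_def)
  have D0: "D c $ 0 = 0" for c
    by (simp add: D_def hom_fps_def comb_fps_below_def egf_def)
  have step: "fps_deriv (D (Suc c) - D c) = fps_const (xvar c) * D c * fps_deriv comb_fps" for c
  proof -
    have "D (Suc c) - D c = ((hom_fps (Suc c) - hom_fps c) oo comb_fps) - (comb_fps_below (Suc c) - comb_fps_below c)"
      by (simp add: D_def fps_compose_sub_distrib)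
    also have "fps_deriv \<dots> = fps_deriv ((hom_fps (Suc c) - hom_fps c) oo comb_fps)
        - fps_deriv (comb_fps_below (Suc c) - comb_fps_below c)"
      by (rule fps_deriv_sub)
    finally have "fps_deriv (D (Suc c) - D c) = ((fps_const (xvar c) * hom_fps c) oo comb_fps) * fps_deriv comb_fps
        - fps_const (xvar c) * comb_fps_below c * fps_deriv comb_fps"
      unfolding fps_compose_deriv[OF F0] hom_fps_Suc comb_fps_below_Suc .
    then show ?thesis
      by (simp add: D_def algebra_simps fps_compose_mult_distrib[OF F0])
  qed
  \<comment> \<open>In the variables of index below \<open>c\<close>, both series already agree with
    \<open>comb_fps\<close>. All factors of \<mu> involve only these variables as well, so the
    argument passes through products.\<close>
  have lim: "xcoeff (D c $ n) \<mu> = 0" if "Poly_Mapping.keys \<mu> \<subseteq> {..<c}" for c n \<mu>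
  proof -
    have "xcoeff ((hom_fps c oo comb_fps) $ n) \<mu> = xcoeff ((fps_X oo comb_fps) $ n) \<mu>"
      unfolding fps_compose_nth xcoeff_sum xcoeff_simps(6)
      by (intro sum.cong refl, clarify, subst xcoeff_hom_fps) (use that in \<open>auto simp: keys_plus\<close>)
    moreover have "xcoeff (comb_fps_below c $ n) \<mu> = xcoeff (comb_fps $ n) \<mu>"
      unfolding comb_fps_below_def comb_fps_def
      by (simp add: egf_def xcoeff_simps(6), intro impI sum.cong refl, clarify, subst xcoeff_comb_gf_below)
        (use that in \<open>auto simp: keys_plus\<close>)
    ultimately show ?thesis
      by (simp add: D_def xcoeff_simps(4) F0)
  qed
  have "D c $ n = 0" for c n
  proof (induction n arbitrary: c rule: less_induct)
    case (less n)
    show ?case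
    proof (cases n)
      case 0
      then show ?thesis by (simp add: D0)
    next
      case (Suc m)
      \<comment> \<open>By \<open>step\<close>, the difference of these coefficients involves only
        lower coefficients of \<open>D c\<close>, which are zero by induction. So the coefficient is
        constant in \<open>c\<close> and equals its limit.\<close>
      have const: "D (Suc c) $ n = D c $ n" for c
      proof -
        have "of_nat (Suc m) * (D (Suc c) - D c) $ Suc m = fps_deriv (D (Suc c) - D c) $ m"
          by (simp only: fps_deriv_nth Suc_eq_plus1)
        also have "\<dots> = 0"
          unfolding step mult.assoc fps_mult_left_const_nth fps_mult_nth
          using less.IH Suc by simp
        finally have "xconst (1 / of_nat (Suc m)) * of_nat (Suc m) * (D (Suc c) - D c) $ Suc m = 0"
          by (simp only: mult.assoc mult_zero_right)
        then show ?thesis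
          unfolding xconst_of_nat[symmetric] xconst_simps(4)[symmetric] by (simp add: xconst_simps Suc)
      qed
      have all: "D (c + k) $ n = D c $ n" for k
        by (induction k) (simp_all add: const)
      show ?thesis
      proof (rule xseries_eqI)
        fix \<mu> :: "nat \<Rightarrow>\<^sub>0 nat"
        obtain k where "Poly_Mapping.keys \<mu> \<subseteq> {..<k}"
          using finite_keys[of \<mu>] unfolding finite_nat_set_iff_bounded by blast
        then have "Poly_Mapping.keys \<mu> \<subseteq> {..<c + k}" by auto
        from lim[OF this, of n] show "xcoeff (D c $ n) \<mu> = xcoeff 0 \<mu>"
          by (simp add: all xcoeff_simps(1))
      qed
    qed
  qed
  then have "D c = 0" by (simp add: fps_eq_iff)
  then show ?thesis by (simp add: D_def)
qed

lemma comb_fps_below_0: "comb_fps_below 0 = fps_X"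
  by (rule fps_ext) (simp add: comb_fps_below_def egf_def comb_gf_below_0 xconst_simps)

lemma hom_from_eq: "hom_from 0 = complete_homogeneous"
  by (rule ext, rule xseries_eqI) (simp add: hom_from_def complete_homogeneous_def xcoeff_simps)

lemma egf_hom_compose:
  "egf (\<lambda>n. (- 1) ^ (n - 1) * complete_homogeneous (n - 1)) oo comb_fps = fps_X"
  using hom_fps_compose[of 0] by (simp add: hom_fps_def hom_from_eq comb_fps_below_0)

text \<open>A bracketing with \<open>n\<close> letters has \<open>n - 1\<close> brackets, so
  restricting to weak compositions of \<open>n - 1\<close> discards only zero coefficients.\<close>

lemma lie_dim_gf_eq:
  assumes "n > 0"
  shows "lie_dim_gf TYPE('k::field) n = comb_gf {1..n}"
proof (rule xseries_eqI)
  fix \<mu> :: "nat \<Rightarrow>\<^sub>0 nat"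
  have "deg (bracket_types t) = size t" for t
    by (induction t) (simp_all add: deg_add)
  then have "colored_combs {1..n} \<mu> = {}" if "deg \<mu> \<noteq> n - 1"
    using that length_letters distinct_card by (fastforce simp: colored_combs_def)
  then show "xcoeff (lie_dim_gf TYPE('k) n) \<mu> = xcoeff (comb_gf {1..n}) \<mu>"
    by (auto simp: lie_dim_gf_def comb_gf_def xcoeff_simps dim_Lie WComp_iff)
qed

lemma egf_lie_dim_gf: "egf (lie_dim_gf TYPE('k::field)) = comb_fps"
  unfolding comb_fps_def by (rule egf_cong) (rule lie_dim_gf_eq)

text \<open>Composing \<open>(f oo g) - fps_X\<close> with \<open>f\<close> on the right gives zero
  by associativity, and over an integral domain composition with a nonzero \<open>f\<close> without
  constant term can be cancelled.\<close>

lemma fps_compose_left_right_inverse: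
  fixes f g :: "'a::idom fps"
  assumes "f $ 0 = 0" "g $ 0 = 0" "g oo f = fps_X"
  shows "f oo g = fps_X"
proof -
  have "f \<noteq> 0"
  proof
    assume "f = 0"
    with assms have "fps_X = (0 :: 'a fps)" by simp
    then show False by simp
  qed
  have "((f oo g) - fps_X) oo f = (f oo (g oo f)) - (fps_X oo f)"
    by (simp only: fps_compose_sub_distrib fps_compose_assoc[OF assms(1,2)])
  also have "\<dots> = 0"
    using assms by simp
  finally show ?thesis
    using \<open>f \<noteq> 0\<close> assms(1) by (simp add: fps_compose_eq_0_iff)
qed

section \<open>Symmetry\<close>

definition permute_vars :: "(nat \<Rightarrow> nat) \<Rightarrow> xseries \<Rightarrow> xseries"
  where "permute_vars p f = Abs_xseries (\<lambda>\<mu>. xcoeff f (Poly_Mapping.map_key p \<mu>))"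

lemma xcoeff_permute_vars [simp]: "xcoeff (permute_vars p f) \<mu> = xcoeff f (Poly_Mapping.map_key p \<mu>)"
  by (simp add: permute_vars_def Abs_xseries_inverse)

lemma map_key_inv:
  assumes "bij p"
  shows "Poly_Mapping.map_key p (Poly_Mapping.map_key (inv p) \<mu>) = \<mu>"
    and "Poly_Mapping.map_key (inv p) (Poly_Mapping.map_key p \<mu>) = \<mu>"
proof -
  have "inj p" "inj (inv p)" "inv p \<circ> p = id" "p \<circ> inv p = id"
    using assms by (auto simp: bij_is_inj bij_is_surj bij_imp_bij_inv surj_f_inv_f fun_eq_iff)
  moreover have "Poly_Mapping.map_key id \<mu> = \<mu>"
    unfolding id_def by (rule map_key_id)
  ultimately show "Poly_Mapping.map_key p (Poly_Mapping.map_key (inv p) \<mu>) = \<mu>"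
    and "Poly_Mapping.map_key (inv p) (Poly_Mapping.map_key p \<mu>) = \<mu>"
    by (simp_all add: map_key_compose)
qed

lemma map_key_eq_0_iff:
  fixes p :: "'a \<Rightarrow> 'a"
  assumes "bij p"
  shows "Poly_Mapping.map_key p \<mu> = 0 \<longleftrightarrow> \<mu> = 0"
proof
  assume "Poly_Mapping.map_key p \<mu> = 0"
  then have "Poly_Mapping.map_key (inv p) (Poly_Mapping.map_key p \<mu>) = 0"
    using bij_is_inj[OF bij_imp_bij_inv[OF assms]] by simp
  then show "\<mu> = 0" by (simp only: map_key_inv[OF assms])
qed (use bij_is_inj[OF assms] in simp)

lemma deg_map_key:
  assumes "bij p"
  shows "deg (Poly_Mapping.map_key p \<mu>) = deg \<mu>"
proof -
  have inj: "inj p" using assms by (rule bij_is_inj)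
  have "deg (Poly_Mapping.map_key p \<mu>) = (\<Sum>i\<in>p -` Poly_Mapping.keys \<mu>. Poly_Mapping.lookup \<mu> (p i))"
    using inj by (simp add: deg_def keys_map_key map_key.rep_eq)
  also have "\<dots> = (\<Sum>i\<in>p ` (p -` Poly_Mapping.keys \<mu>). Poly_Mapping.lookup \<mu> i)"
    by (simp only: sum.reindex[OF inj_on_subset[OF inj subset_UNIV]] comp_def)
  also have "p ` (p -` Poly_Mapping.keys \<mu>) = Poly_Mapping.keys \<mu>"
    using assms by (simp add: bij_is_surj surj_image_vimage_eq)
  finally show ?thesis by (simp add: deg_def)
qed

lemma permute_vars_simps:
  assumes "bij p"
  shows "permute_vars p 0 = 0" "permute_vars p 1 = 1" "permute_vars p (xconst r) = xconst r"
    "permute_vars p (f + g) = permute_vars p f + permute_vars p g"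
    "permute_vars p (- f) = - permute_vars p f"
    "permute_vars p (f * g) = permute_vars p f * permute_vars p g"
proof -
  have inj: "inj p" using assms by (rule bij_is_inj)
  show "permute_vars p (f * g) = permute_vars p f * permute_vars p g"
  proof (rule xseries_eqI)
    fix \<mu> :: "nat \<Rightarrow>\<^sub>0 nat"
    let ?m = "Poly_Mapping.map_key p" and ?n = "Poly_Mapping.map_key (inv p) :: (nat \<Rightarrow>\<^sub>0 nat) \<Rightarrow> _"
    have "(\<Sum>(\<alpha>, \<beta>)\<in>{(\<alpha>, \<beta>). \<alpha> + \<beta> = ?m \<mu>}. xcoeff f \<alpha> * xcoeff g \<beta>) =
        (\<Sum>(\<alpha>, \<beta>)\<in>{(\<alpha>, \<beta>). \<alpha> + \<beta> = \<mu>}. xcoeff f (?m \<alpha>) * xcoeff g (?m \<beta>))"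
      using assms inj bij_is_inj[OF bij_imp_bij_inv[OF assms]]
      by (intro sum.reindex_bij_witness[where i = "map_prod ?m ?m" and j = "map_prod ?n ?n"])
        (auto simp: map_key_inv simp flip: map_key_plus)
    then show "xcoeff (permute_vars p (f * g)) \<mu> = xcoeff (permute_vars p f * permute_vars p g) \<mu>"
      by (simp add: xcoeff_simps)
  qed
qed (rule xseries_eqI; simp add: xcoeff_simps map_key_eq_0_iff[OF assms])+

lemma permute_vars_sum: "bij p \<Longrightarrow> permute_vars p (sum f A) = (\<Sum>x\<in>A. permute_vars p (f x))"
  by (induction A rule: infinite_finite_induct) (auto simp: permute_vars_simps)

lemma permute_vars_complete_homogeneous:
  "bij p \<Longrightarrow> permute_vars p (complete_homogeneous n) = complete_homogeneous n"
  by (rule xseries_eqI) (simp add: complete_homogeneous_def xcoeff_simps WComp_iff deg_map_key)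

text \<open>Permuting variables is a ring homomorphism fixing the coefficients of \<open>?H\<close>,
  so the permuted series \<open>G\<close> is again a right inverse of \<open>?H\<close>. As
  \<open>comb_fps\<close> is a left inverse, the two coincide.\<close>

lemma permute_vars_comb_fps:
  assumes p: "bij p"
  shows "permute_vars p (comb_fps $ n) = comb_fps $ n"
proof -
  let ?H = "egf (\<lambda>n. (- 1) ^ (n - 1) * complete_homogeneous (n - 1))"
  define G where "G = Abs_fps (\<lambda>n. permute_vars p (comb_fps $ n))"
  have F0: "comb_fps $ 0 = 0" and H0: "?H $ 0 = 0" by (simp_all add: comb_fps_def egf_def)
  have G0: "G $ 0 = 0" by (simp add: G_def F0 permute_vars_simps p)
  \<comment> \<open>Coefficients of a composition are expressed through powers of the inner
    series.\<close>
  have pow: "(G ^ i) $ n = permute_vars p ((comb_fps ^ i) $ n)" for i n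
    by (induction i arbitrary: n)
      (auto simp: fps_mult_nth permute_vars_sum permute_vars_simps p G_def)
  have "permute_vars p ((- 1) ^ i) = (- 1) ^ i" for i
    by (induction i) (simp_all add: permute_vars_simps p)
  then have H: "permute_vars p (?H $ i) = ?H $ i" for i
    by (simp add: egf_def permute_vars_simps permute_vars_complete_homogeneous p)
  have "?H oo G = fps_X"
  proof (rule fps_ext)
    fix n
    have "(?H oo G) $ n = permute_vars p ((?H oo comb_fps) $ n)"
      unfolding fps_compose_nth permute_vars_sum[OF p] permute_vars_simps(6)[OF p] H pow ..
    then show "(?H oo G) $ n = fps_X $ n"
      unfolding egf_hom_compose by (simp add: permute_vars_simps p)
  qed
  then have "comb_fps = (comb_fps oo ?H) oo G"
    unfolding fps_compose_assoc[OF G0 H0, symmetric] by simp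
  also have "comb_fps oo ?H = fps_X"
    by (rule fps_compose_left_right_inverse[OF F0 H0 egf_hom_compose])
  finally have "comb_fps = G" by (simp add: G0)
  then show ?thesis by (metis G_def fps_nth_Abs_fps)
qed

lemma symmetric_function_lie_dim_gf:
  assumes "n \<ge> 1"
  shows "symmetric_function (lie_dim_gf TYPE('k::field) n)"
  unfolding symmetric_function_def
proof (intro conjI exI[of _ "n - 1"] allI impI)
  fix m \<mu> assume "\<mu> \<in> WComp m" "xcoeff (lie_dim_gf TYPE('k) n) \<mu> \<noteq> 0"
  then show "m \<le> n - 1"
    by (auto simp: lie_dim_gf_def xcoeff_simps WComp_iff split: if_splits)
next
  fix p :: "nat \<Rightarrow> nat" and \<mu> assume p: "bij p"
  have eq: "comb_fps $ n = xconst (1 / fact n) * comb_gf {1..n}"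
    using assms by (simp add: comb_fps_def egf_def)
  have "xconst (fact n) * xconst (1 / fact n) = 1"
    by (simp add: xconst_simps flip: xconst_simps(4))
  \<comment> \<open>Clearing the factorial transfers the invariance from the coefficient of
    \<open>comb_fps\<close> to \<open>comb_gf\<close>.\<close>
  then have gf: "comb_gf {1..n} = xconst (fact n) * comb_fps $ n"
    by (simp add: eq flip: mult.assoc)
  have "permute_vars p (comb_gf {1..n}) = comb_gf {1..n}"
    unfolding gf by (simp add: permute_vars_simps permute_vars_comb_fps p)
  then show "xcoeff (lie_dim_gf TYPE('k) n) (Poly_Mapping.map_key p \<mu>) = xcoeff (lie_dim_gf TYPE('k) n) \<mu>"
    using assms by (simp add: lie_dim_gf_eq flip: xcoeff_permute_vars)
qed

theorem theorem1p5:
  shows "(\<forall>n\<ge>1. symmetric_function (lie_dim_gf TYPE('k::field) n)) \<and>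
    compositional_inverse
      (egf (lie_dim_gf TYPE('k)))
      (egf (\<lambda>n. (- 1) ^ (n - 1) * complete_homogeneous (n - 1)))"
proof -
  let ?H = "egf (\<lambda>n. (- 1) ^ (n - 1) * complete_homogeneous (n - 1))"
  have "comb_fps $ 0 = 0" "?H $ 0 = 0"
    by (simp_all add: comb_fps_def egf_def)
  then show ?thesis
    using symmetric_function_lie_dim_gf egf_hom_compose fps_compose_left_right_inverse[of comb_fps ?H]
    by (auto simp: compositional_inverse_def egf_lie_dim_gf)
qed

end
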